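(* Let $(X,\mu,\mathcal{E},\mathcal{F})$ be a symmetric Dirichlet space with conservative semigroup $\{P_t\}_{t\ge 0}$. Let $1<p\le 2$. There exists a constant $C_p>0$ such that for every $f\in L^p(X,\mu)$ and every $t>0$, \[ \|P_tf\|_{p,1/2}\le \frac{C_p}{t^{1/2}}\,\|f\|_{L^p(X,\mu)} . \] In particular, for $1<p\le 2$ and $t>0$, the operator $P_t:L^p(X,\mu)\to \mathbf{B}^{p,1/2}(X)$ is bounded.
   Context: $X$ is a topological space equipped with a Radon measure $\mu$; $\mathcal{E}$ is a symmetric Dirichlet form (closed Markovian symmetric bilinear form) on $L^2(X,\mu)$ with domain $\mathcal{F}$. $\{P_t\}_{t\ge0}$ is the associated Markovian semigroup, extended to a positive contraction semigroup on every $L^p(X,\mu)$, $1\le p\le\infty$. Standing assumption: $P_t$ is conservative, i.e. $P_t1=1$. For $p\ge1$, $\alpha\ge0$ and $f\in L^p(X,\mu)$ define the Besov seminorm \[ \|f\|_{p,\alpha}=\sup_{t>0}t^{-\alpha}\left(\int_X P_t(|f-f(y)|^p)(y)\,d\mu(y)\right)^{1/p}, \] where the inner expression is understood through the heat kernel measures of $P_t$; if $P_t$ has a heat kernel $p_t(x,y)$, the integral equals $\int_X\int_X|f(x)-f(y)|^pp_t(x,y)\,d\mu(x)\,d\mu(y)$. The Besov space is $\mathbf{B}^{p,\alpha}(X)=\{f\in L^p(X,\mu):\|f\|_{p,\alpha}<\infty\}$ with norm $\|f\|_{L^p(X,\mu)}+\|f\|_{p,\alpha}$. *)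

theory Defs
  imports "HOL-Probability.Probability"
begin

text \<open>
  Elements of \<open>L\<^sup>p\<close> are represented by measurable real functions, and every identity between
  elements of \<open>L\<^sup>p\<close> is stated almost everywhere.
\<close>

text \<open>Compact sets need not be Borel in a non-Hausdorff space, so measurability of \<open>K\<close> is required.\<close>

definition radon_measure :: "'a::topological_space measure \<Rightarrow> bool" where
  "radon_measure M \<longleftrightarrow>
     sets M = sets borel \<and>
     (\<forall>x. \<exists>U. open U \<and> x \<in> U \<and> emeasure M U < \<infinity>) \<and>
     (\<forall>A\<in>sets M. emeasure M A = (SUP K\<in>{K. compact K \<and> K \<in> sets M \<and> K \<subseteq> A}. emeasure M K))"

text \<open>For \<open>p > 0\<close> this is \<open>x\<close> to the power \<open>1/p\<close>, with the value \<open>\<infinity>\<close> at \<open>\<infinity>\<close>.\<close>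

definition ennroot :: "real \<Rightarrow> ennreal \<Rightarrow> ennreal" where
  "ennroot p x = (if x = \<infinity> then \<infinity> else ennreal (enn2real x powr (1 / p)))"

text \<open>Exponents range over \<open>[1, \<infinity>]\<close> as a part of \<^typ>\<open>ennreal\<close>.\<close>

definition Lnorm :: "'a measure \<Rightarrow> ennreal \<Rightarrow> ('a \<Rightarrow> real) \<Rightarrow> ennreal" where
  "Lnorm M p f =
     (if p = \<infinity> then esssup M (\<lambda>x. ennreal \<bar>f x\<bar>)
      else ennroot (enn2real p) (\<integral>\<^sup>+x. ennreal (\<bar>f x\<bar> powr enn2real p) \<partial>M))"

definition Lp :: "'a measure \<Rightarrow> ennreal \<Rightarrow> ('a \<Rightarrow> real) set" where
  "Lp M p = {f \<in> borel_measurable M. Lnorm M p f < \<infinity>}"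

definition L2_inner :: "'a measure \<Rightarrow> ('a \<Rightarrow> real) \<Rightarrow> ('a \<Rightarrow> real) \<Rightarrow> real" where
  "L2_inner M f g = (\<integral>x. f x * g x \<partial>M)"

text \<open>
  The second and third conditions say that \<open>F\<close> and \<open>E\<close> depend only on classes modulo null sets.
  The last two are closedness (completeness of \<open>F\<close> in the norm of \<open>E\<^sub>1 = E + \<langle>\<cdot>,\<cdot>\<rangle>\<close>) and the
  Markov property (the unit contraction operates on \<open>E\<close>).
\<close>

definition symmetric_dirichlet_form ::
  "'a measure \<Rightarrow> (('a \<Rightarrow> real) \<Rightarrow> ('a \<Rightarrow> real) \<Rightarrow> real) \<Rightarrow> ('a \<Rightarrow> real) set \<Rightarrow> bool" where
  "symmetric_dirichlet_form M E F \<longleftrightarrow>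
     F \<subseteq> Lp M 2 \<and>
     (\<forall>f\<in>F. \<forall>g\<in>borel_measurable M. (AE x in M. f x = g x) \<longrightarrow> g \<in> F) \<and>
     (\<forall>f\<in>F. \<forall>g\<in>F. \<forall>h\<in>F. (AE x in M. f x = g x) \<longrightarrow> E f h = E g h) \<and>
     (\<lambda>x. 0) \<in> F \<and>
     (\<forall>f\<in>F. \<forall>g\<in>F. \<forall>a b. (\<lambda>x. a * f x + b * g x) \<in> F) \<and>
     (\<forall>f\<in>Lp M 2. \<forall>e>0. \<exists>g\<in>F. Lnorm M 2 (\<lambda>x. f x - g x) < e) \<and>
     (\<forall>f\<in>F. \<forall>g\<in>F. \<forall>h\<in>F. \<forall>a b. E (\<lambda>x. a * f x + b * g x) h = a * E f h + b * E g h) \<and>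
     (\<forall>f\<in>F. \<forall>g\<in>F. E f g = E g f) \<and>
     (\<forall>f\<in>F. 0 \<le> E f f) \<and>
     (let E1 = (\<lambda>f. E f f + L2_inner M f f) in
        \<forall>u. (\<forall>n::nat. u n \<in> F) \<and>
            (\<forall>e>0. \<exists>N. \<forall>m\<ge>N. \<forall>n\<ge>N. E1 (\<lambda>x. u m x - u n x) < e) \<longrightarrow>
            (\<exists>v\<in>F. (\<lambda>n. E1 (\<lambda>x. u n x - v x)) \<longlonglongrightarrow> 0)) \<and>
     (\<forall>f\<in>F. (\<lambda>x. min (max (f x) 0) 1) \<in> F \<and>
            E (\<lambda>x. min (max (f x) 0) 1) (\<lambda>x. min (max (f x) 0) 1) \<le> E f f)"

text \<open>
  The same \<open>P t\<close> acts on all the spaces \<open>L\<^sup>p\<close>, so the actions for different \<open>p\<close> are consistent.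
  Invariance of \<open>P t\<close> under change on a null set follows from linearity and contractivity.
\<close>

definition positive_contraction_semigroup ::
  "'a measure \<Rightarrow> (real \<Rightarrow> ('a \<Rightarrow> real) \<Rightarrow> 'a \<Rightarrow> real) \<Rightarrow> ennreal \<Rightarrow> bool" where
  "positive_contraction_semigroup M P p \<longleftrightarrow>
     (\<forall>t\<ge>0. \<forall>f\<in>Lp M p. P t f \<in> Lp M p \<and> Lnorm M p (P t f) \<le> Lnorm M p f) \<and>
     (\<forall>t\<ge>0. \<forall>f\<in>Lp M p. \<forall>g\<in>Lp M p. \<forall>a b.
        AE x in M. P t (\<lambda>y. a * f y + b * g y) x = a * P t f x + b * P t g x) \<and>
     (\<forall>t\<ge>0. \<forall>f\<in>Lp M p. (AE x in M. 0 \<le> f x) \<longrightarrow> (AE x in M. 0 \<le> P t f x)) \<and>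
     (\<forall>f\<in>Lp M p. AE x in M. P 0 f x = f x) \<and>
     (\<forall>s\<ge>0. \<forall>t\<ge>0. \<forall>f\<in>Lp M p. AE x in M. P (s + t) f x = P s (P t f) x)"

text \<open>
  The semigroup on \<open>L\<^sup>2\<close> is associated with \<open>(E, F)\<close> if its infinitesimal generator is the
  generator \<open>L\<close> of the form, i.e. \<open>L f = h\<close> iff \<open>f \<in> F\<close> and \<open>E f g = - \<langle>h, g\<rangle>\<close> for all \<open>g \<in> F\<close>.
\<close>

definition dirichlet_semigroup ::
  "'a measure \<Rightarrow> (('a \<Rightarrow> real) \<Rightarrow> ('a \<Rightarrow> real) \<Rightarrow> real) \<Rightarrow> ('a \<Rightarrow> real) set
   \<Rightarrow> (real \<Rightarrow> ('a \<Rightarrow> real) \<Rightarrow> 'a \<Rightarrow> real) \<Rightarrow> bool" where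
  "dirichlet_semigroup M E F P \<longleftrightarrow>
     (\<forall>p\<ge>1. positive_contraction_semigroup M P p) \<and>
     (\<forall>t\<ge>0. \<forall>f\<in>Lp M 2. \<forall>g\<in>Lp M 2. L2_inner M (P t f) g = L2_inner M f (P t g)) \<and>
     (\<forall>f\<in>Lp M 2. ((\<lambda>t. Lnorm M 2 (\<lambda>x. P t f x - f x)) \<longlongrightarrow> 0) (at_right 0)) \<and>
     (\<forall>f\<in>Lp M 2. \<forall>h\<in>Lp M 2.
        ((\<lambda>t. Lnorm M 2 (\<lambda>x. (P t f x - f x) / t - h x)) \<longlongrightarrow> 0) (at_right 0) \<longleftrightarrow>
        f \<in> F \<and> (\<forall>g\<in>F. E f g = - L2_inner M h g))"

definition conservative ::
  "'a measure \<Rightarrow> (real \<Rightarrow> ('a \<Rightarrow> real) \<Rightarrow> 'a \<Rightarrow> real) \<Rightarrow> bool" where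
  "conservative M P \<longleftrightarrow> (\<forall>t\<ge>0. AE x in M. P t (\<lambda>_. 1) x = 1)"

text \<open>\<open>K t x\<close> is the heat kernel measure \<open>p\<^sub>t(x, dy)\<close>; its values at \<open>t \<le> 0\<close> play no role.\<close>

definition heat_kernel_measures ::
  "'a measure \<Rightarrow> (real \<Rightarrow> ('a \<Rightarrow> real) \<Rightarrow> 'a \<Rightarrow> real) \<Rightarrow> (real \<Rightarrow> 'a \<Rightarrow> 'a measure) \<Rightarrow> bool" where
  "heat_kernel_measures M P K \<longleftrightarrow>
     (\<forall>t>0. K t \<in> M \<rightarrow>\<^sub>M subprob_algebra M \<and>
        (\<forall>p\<ge>1. \<forall>f\<in>Lp M p.
           AE x in M. integrable (K t x) f \<and> P t f x = (\<integral>y. f y \<partial>K t x)))"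

definition besov_seminorm ::
  "'a measure \<Rightarrow> (real \<Rightarrow> 'a \<Rightarrow> 'a measure) \<Rightarrow> real \<Rightarrow> real \<Rightarrow> ('a \<Rightarrow> real) \<Rightarrow> ennreal" where
  "besov_seminorm M K p \<alpha> f =
     (SUP t\<in>{0<..}. ennreal (t powr (- \<alpha>)) *
        ennroot p (\<integral>\<^sup>+y. (\<integral>\<^sup>+x. ennreal (\<bar>f x - f y\<bar> powr p) \<partial>K t y) \<partial>M))"

definition besov_space ::
  "'a measure \<Rightarrow> (real \<Rightarrow> 'a \<Rightarrow> 'a measure) \<Rightarrow> real \<Rightarrow> real \<Rightarrow> ('a \<Rightarrow> real) set" where
  "besov_space M K p \<alpha> = {f \<in> Lp M (ennreal p). besov_seminorm M K p \<alpha> f < \<infinity>}"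

definition besov_norm ::
  "'a measure \<Rightarrow> (real \<Rightarrow> 'a \<Rightarrow> 'a measure) \<Rightarrow> real \<Rightarrow> real \<Rightarrow> ('a \<Rightarrow> real) \<Rightarrow> ennreal" where
  "besov_norm M K p \<alpha> f = Lnorm M (ennreal p) f + besov_seminorm M K p \<alpha> f"

end

theory Submission
  imports Defs
begin

text \<open>
  Write \<open>Q = P\<^sub>r\<close> and \<open>B(a, b) = |a|\<^sup>p - |b|\<^sup>p - p sgn(b) |b|\<^sup>p\<^sup>-\<^sup>1 (a - b)\<close>. Integrating \<open>B(f x, Q f y)\<close> against
  the kernel of \<open>Q\<close> gives at most \<open>\<parallel>f\<parallel>\<^sub>p\<^sup>p - \<parallel>Q f\<parallel>\<^sub>p\<^sup>p\<close>, and \<open>B(a, b)\<close> dominates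
  \<open>(a - b)\<^sup>2 (|a| + |b|)\<^sup>p\<^sup>-\<^sup>2\<close>. By duality, \<open>f - Q\<^sup>2 f\<close> is controlled by that drop of the norm.
  The drops telescope along the semigroup, hence \<open>\<parallel>(I - P\<^sub>s) P\<^sub>t f\<parallel>\<^sub>p \<le> C (s/t)\<^sup>1\<^sup>/\<^sup>2 \<parallel>f\<parallel>\<^sub>p\<close>.
  Iterating, the third difference decays like \<open>(s/t)\<^sup>3\<^sup>/\<^sup>2\<close>, and since this exponent exceeds \<open>1\<close>, comparing the scales
  \<open>s\<close> and \<open>2 s\<close> (as in Marchaud's inequality) yields \<open>\<parallel>(I - P\<^sub>s) P\<^sub>t f\<parallel>\<^sub>p \<le> C (s/t) \<parallel>f\<parallel>\<^sub>p\<close>, which replaces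
  Stein's theorem on the analyticity of the semigroup. Applied to \<open>g = P\<^sub>t f\<close> it bounds \<open>\<parallel>g\<parallel>\<^sub>p\<^sup>p - \<parallel>P\<^sub>s g\<parallel>\<^sub>p\<^sup>p\<close>,
  hence the deviation of \<open>g\<close> from \<open>P\<^sub>s g\<close> under the kernel of \<open>P\<^sub>s\<close>.
\<close>

section \<open>Powers of real numbers\<close>

definition signed_powr :: "real \<Rightarrow> real \<Rightarrow> real" where
  "signed_powr a b = sgn b * \<bar>b\<bar> powr a"

text \<open>The derivative of the p-th power of the modulus at \<open>b\<close> is
  \<open>p * signed_powr (p - 1) b\<close>, so this is the height of its graph at \<open>a\<close>
  above the tangent at \<open>b\<close>. Under a probability measure with mean \<open>b\<close> the
  tangent term integrates to zero.\<close>

definition powr_bregman :: "real \<Rightarrow> real \<Rightarrow> real \<Rightarrow> real" where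
  "powr_bregman p a b = \<bar>a\<bar> powr p - \<bar>b\<bar> powr p - p * signed_powr (p - 1) b * (a - b)"

lemma powr_minus_one_mult: "b \<ge> 0 \<Longrightarrow> b powr (p - 1) * b = b powr p" for b p :: real
  by (cases "b = 0") (simp_all add: powr_diff)

text \<open>Midpoint convexity gives the factor \<open>2 powr (p - 1)\<close>, which is at most
  \<open>2\<close> here.\<close>

lemma powr_add_le:
  fixes a b p :: real
  assumes "1 \<le> p" "p \<le> 2" "0 \<le> a" "0 \<le> b"
  shows "(a + b) powr p \<le> 2 * (a powr p + b powr p)"
proof (cases "a = 0 \<or> b = 0")
  case True
  then show ?thesis by auto
next
  case False
  then have ab: "a > 0" "b > 0" using assms by auto
  have "((1/2) * a + (1/2) * b) powr p \<le> (1/2) * a powr p + (1/2) * b powr p"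
    using convex_onD[OF powr_convex[OF assms(1)], of "1/2" a b] ab by simp
  then have "((a + b) / 2) powr p \<le> (a powr p + b powr p) / 2"
    by (simp add: add_divide_distrib)
  then have "2 powr p * ((a + b) / 2) powr p \<le> 2 powr p * ((a powr p + b powr p) / 2)"
    by (intro mult_left_mono) auto
  moreover have "2 powr p * ((a + b) / 2) powr p = (a + b) powr p"
    using ab by (simp add: powr_divide)
  moreover have "2 powr p * ((a powr p + b powr p) / 2) \<le> 4 * ((a powr p + b powr p) / 2)"
    using powr_mono[of p 2 2] assms by (intro mult_right_mono) auto
  ultimately show ?thesis by simp
qed

text \<open>Below \<open>a + b\<close> the second derivative of the p-th power is at least
  \<open>(p - 1) * (a + b) powr (p - 2)\<close>, because \<open>p - 2 \<le> 0\<close>. Subtracting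
  the parabola with that second derivative leaves a convex function, whose tangent inequality at
  \<open>b\<close> is the claim. Zero arguments lie outside the open interval and are computed
  directly.\<close>

lemma powr_bregman_ge_pos:
  fixes a b p :: real
  assumes p: "1 < p" "p \<le> 2" and "a \<ge> 0" "b \<ge> 0" "a + b > 0"
  shows "powr_bregman p a b \<ge> (p - 1) / 2 * ((a - b)\<^sup>2 * (a + b) powr (p - 2))"
proof (cases "a = 0 \<or> b = 0")
  case True
  have sq: "x\<^sup>2 * x powr (p - 2) = x powr p" if "x > 0" for x :: real
    using that powr_add[of x 2 "p - 2"] by simp
  show ?thesis
  proof (cases "b = 0")
    case True
    have "(p - 1) / 2 * a powr p \<le> 1 * a powr p"
      using p by (intro mult_right_mono) auto
    then show ?thesis using True assms sq[of a] by (simp add: powr_bregman_def signed_powr_def)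
  next
    case False
    then have [simp]: "a = 0" and "b > 0" using True assms by auto
    have "(p - 1) / 2 * b powr p \<le> (p - 1) * b powr p"
      using p by (intro mult_right_mono) auto
    then show ?thesis using False assms sq[of b] powr_minus_one_mult[of b p]
      by (simp add: powr_bregman_def signed_powr_def algebra_simps)
  qed
next
  case False
  then have ab: "a > 0" "b > 0" using assms by auto
  define c where "c = (p - 1) / 2 * (a + b) powr (p - 2)"
  have c0: "c \<ge> 0" using p by (auto simp: c_def)
  let ?f = "\<lambda>x. x powr p - c * x\<^sup>2"
  let ?f' = "\<lambda>x. p * x powr (p - 1) - 2 * c * x"
  have f': "(?f has_real_derivative ?f' x) (at x)" if "x > 0" for x
    using that by (auto intro!: derivative_eq_intros)
  have f'': "(?f' has_real_derivative p * (p - 1) * x powr (p - 2) - 2 * c) (at x)" if "x > 0" for x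
    using that by (auto intro!: derivative_eq_intros simp: algebra_simps)
  have conv: "convex_on {0<..<a + b} ?f"
  proof (rule f''_ge0_imp_convex)
    fix x assume x: "x \<in> {0<..<a + b}"
    have "1 * ((p - 1) * (a + b) powr (p - 2)) \<le> p * ((p - 1) * x powr (p - 2))"
      using p x by (intro mult_mono powr_mono2') auto
    moreover have "2 * c = (p - 1) * (a + b) powr (p - 2)"
      by (simp add: c_def)
    ultimately show "0 \<le> p * (p - 1) * x powr (p - 2) - 2 * c"
      by simp
  qed (use f' f'' in auto)
  have "?f a - ?f b \<ge> ?f' b * (a - b)"
    by (rule convex_on_imp_above_tangent[OF conv])
       (use ab f'[of b] in \<open>auto intro: has_field_derivative_at_within\<close>)
  moreover have "c * a\<^sup>2 - c * b\<^sup>2 - 2 * c * b * (a - b) = c * (a - b)\<^sup>2"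
    by (simp add: power2_eq_square algebra_simps)
  ultimately have "a powr p - b powr p - p * b powr (p - 1) * (a - b) \<ge> c * (a - b)\<^sup>2"
    by (simp add: algebra_simps)
  then show ?thesis using ab
    by (simp add: powr_bregman_def signed_powr_def c_def algebra_simps)
qed

lemma powr_bregman_uminus: "powr_bregman p (- a) (- b) = powr_bregman p a b"
  by (simp add: powr_bregman_def signed_powr_def algebra_simps sgn_minus)

text \<open>Reflection makes \<open>b\<close> nonnegative, and then only \<open>a < 0\<close> is
  new. There the divergence is a sum of three nonnegative terms, two of which already dominate the
  other side.\<close>

lemma powr_bregman_ge:
  fixes a b p :: real
  assumes p: "1 < p" "p \<le> 2" and ab: "\<bar>a\<bar> + \<bar>b\<bar> > 0"
  shows "powr_bregman p a b \<ge> (p - 1) / 2 * ((a - b)\<^sup>2 * (\<bar>a\<bar> + \<bar>b\<bar>) powr (p - 2))"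
proof -
  have main: "powr_bregman p a b \<ge> (p - 1) / 2 * ((a - b)\<^sup>2 * (\<bar>a\<bar> + \<bar>b\<bar>) powr (p - 2))"
    if b: "b \<ge> 0" and ab: "\<bar>a\<bar> + \<bar>b\<bar> > 0" for a b :: real
  proof (cases "a \<ge> 0")
    case True
    then show ?thesis using powr_bregman_ge_pos[OF p True b] ab b by simp
  next
    case False
    \<comment> \<open>Opposite signs turn \<open>\<bar>a\<bar> + \<bar>b\<bar>\<close> into
      \<open>b - a\<close>, so the square and the weight merge into one power.\<close>
    have "(a - b)\<^sup>2 * (\<bar>a\<bar> + \<bar>b\<bar>) powr (p - 2) = (b - a) powr p"
      using False b powr_add[of "b - a" 2 "p - 2"] by (simp add: power2_commute)
    also have "\<dots> \<le> 2 * ((- a) powr p + b powr p)"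
      using powr_add_le[of p "- a" b] p False b by (simp add: algebra_simps)
    finally have "(p - 1) / 2 * ((a - b)\<^sup>2 * (\<bar>a\<bar> + \<bar>b\<bar>) powr (p - 2))
        \<le> (p - 1) / 2 * (2 * ((- a) powr p + b powr p))"
      using p by (intro mult_left_mono) auto
    also have "\<dots> = (p - 1) * (- a) powr p + (p - 1) * b powr p"
      by (simp add: field_simps)
    also have "\<dots> \<le> 1 * (- a) powr p + (p - 1) * b powr p + p * b powr (p - 1) * (- a)"
    proof -
      have "(p - 1) * (- a) powr p \<le> 1 * (- a) powr p"
        using p by (intro mult_right_mono) auto
      moreover have "0 \<le> p * b powr (p - 1) * (- a)"
        using p False by (intro mult_nonneg_nonneg) auto
      ultimately show ?thesis by linarith
    qed
    also have "\<dots> = powr_bregman p a b"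
      using False b powr_minus_one_mult[of b p]
      by (cases "b = 0") (auto simp: powr_bregman_def signed_powr_def algebra_simps)
    finally show ?thesis .
  qed
  show ?thesis
  proof (cases "b \<ge> 0")
    case True
    then show ?thesis using main ab by auto
  next
    case False
    then show ?thesis using main[of "- b" "- a"] ab
      by (simp add: powr_bregman_uminus power2_commute)
  qed
qed

text \<open>Two regimes. If the difference is at most \<open>e\<close> times
  \<open>\<bar>a\<bar> + \<bar>b\<bar>\<close>, the second term suffices. Otherwise the nonpositive
  exponent \<open>p - 2\<close> allows the difference to be replaced by that threshold, and the
  divergence takes over. The free \<open>e\<close> is later tuned to a ratio of times.\<close>

lemma powr_diff_le_bregman:
  fixes a b p e :: real
  assumes p: "1 < p" "p \<le> 2" and e: "e > 0"
  shows "\<bar>a - b\<bar> powr p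
    \<le> 2 / (p - 1) * e powr (p - 2) * powr_bregman p a b + 2 * e powr p * (\<bar>a\<bar> powr p + \<bar>b\<bar> powr p)"
proof (cases "\<bar>a\<bar> + \<bar>b\<bar> > 0 \<and> a \<noteq> b")
  case False
  then have "a = b" by linarith
  then show ?thesis by (auto simp: powr_bregman_def)
next
  case True
  define S where "S = \<bar>a\<bar> + \<bar>b\<bar>"
  have S: "S > 0" using True by (simp add: S_def)
  have B: "powr_bregman p a b \<ge> (p - 1) / 2 * ((a - b)\<^sup>2 * S powr (p - 2))"
    using powr_bregman_ge[OF p] True by (simp add: S_def)
  then have B0: "powr_bregman p a b \<ge> 0"
    by (rule order_trans[rotated]) (use p in auto)
  show ?thesis
  proof (cases "\<bar>a - b\<bar> \<le> e * S")
    case True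
    then have "\<bar>a - b\<bar> powr p \<le> (e * S) powr p"
      using p by (intro powr_mono2) auto
    also have "\<dots> = e powr p * S powr p"
      using e S by (simp add: powr_mult)
    also have "\<dots> \<le> e powr p * (2 * (\<bar>a\<bar> powr p + \<bar>b\<bar> powr p))"
      unfolding S_def using p by (intro mult_left_mono powr_add_le) auto
    finally have "\<bar>a - b\<bar> powr p \<le> 2 * e powr p * (\<bar>a\<bar> powr p + \<bar>b\<bar> powr p)"
      by (simp only: mult_ac)
    moreover have "0 \<le> 2 / (p - 1) * e powr (p - 2) * powr_bregman p a b"
      using p B0 by auto
    ultimately show ?thesis by linarith
  next
    case False
    have "\<bar>a - b\<bar> powr p = (a - b)\<^sup>2 * \<bar>a - b\<bar> powr (p - 2)"
      using True powr_add[of "\<bar>a - b\<bar>" 2 "p - 2"] by simp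
    also have "\<dots> \<le> (a - b)\<^sup>2 * (e * S) powr (p - 2)"
      using False S e p by (intro mult_left_mono powr_mono2') auto
    also have "\<dots> = 2 / (p - 1) * e powr (p - 2) * ((p - 1) / 2 * ((a - b)\<^sup>2 * S powr (p - 2)))"
      using e S p by (simp add: powr_mult field_simps)
    also have "\<dots> \<le> 2 / (p - 1) * e powr (p - 2) * powr_bregman p a b"
      using B p by (intro mult_left_mono) auto
    finally show ?thesis by (smt (verit) mult_nonneg_nonneg powr_ge_zero)
  qed
qed

text \<open>A form of Young's inequality whose coefficient \<open>1 / 2\<close> permits absorption:
  in the duality argument the integral of \<open>y powr p\<close> stands on both sides.\<close>

lemma mult_powr_minus_one_le:
  fixes x y p :: real
  assumes p: "1 < p" "p \<le> 2" and xy: "0 \<le> x" "0 \<le> y"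
  shows "x * y powr (p - 1) \<le> 2 * x powr p + y powr p / 2"
proof (cases "2 * x \<le> y")
  case True
  then have "2 * x * y powr (p - 1) \<le> y * y powr (p - 1)"
    by (intro mult_right_mono) auto
  then have "2 * (x * y powr (p - 1)) \<le> y powr p"
    using powr_minus_one_mult[of y p] xy by (simp add: mult_ac)
  moreover have "0 \<le> 2 * x powr p" by simp
  ultimately show ?thesis by linarith
next
  case False
  then have "x * y powr (p - 1) \<le> x * (2 * x) powr (p - 1)"
    using p xy by (intro mult_left_mono powr_mono2) auto
  also have "\<dots> = 2 powr (p - 1) * x powr p"
    using xy powr_minus_one_mult[of x p] by (simp add: powr_mult mult_ac)
  also have "\<dots> \<le> 2 powr 1 * x powr p"
    using p by (intro mult_right_mono powr_mono) auto
  finally show ?thesis by (simp add: add_increasing2)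
qed

text \<open>The tangent at \<open>a\<close> lies below the graph at \<open>b\<close>.\<close>

lemma powr_diff_le:
  fixes a b p :: real
  assumes "1 \<le> p" "0 \<le> b" "b \<le> a"
  shows "a powr p - b powr p \<le> p * a powr (p - 1) * (a - b)"
proof (cases "b = 0")
  case True
  have "1 * a powr p \<le> p * a powr p" using assms by (intro mult_right_mono) auto
  then show ?thesis using assms powr_minus_one_mult[of a p] True by (simp add: mult.assoc)
next
  case False
  then have ab: "a > 0" "b > 0" using assms by auto
  have "(\<lambda>x. x powr p) b - (\<lambda>x. x powr p) a \<ge> (p * a powr (p - 1)) * (b - a)"
    by (rule convex_on_imp_above_tangent[OF powr_convex[OF assms(1)]])
       (use ab in \<open>auto intro!: derivative_eq_intros simp: interior_open\<close>)
  then show ?thesis by (simp add: algebra_simps)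
qed

text \<open>Each use of \<open>step\<close> doubles the scale, until it exceeds \<open>1\<close> and
  the uniform bound applies. The induction counts the doublings.\<close>

lemma double_scale_bound:
  fixes c :: "real \<Rightarrow> real"
  assumes step: "\<And>x. x > 0 \<Longrightarrow> c x \<le> c (2 * x) / 4 + k * x powr (3 / 2)"
    and bound: "\<And>x. x > 0 \<Longrightarrow> c x \<le> B"
    and k: "0 \<le> k" and B: "0 \<le> B" and x: "x > 0"
  shows "c x \<le> (B + 4 * k) * x powr (3 / 2)"
proof -
  have "c x \<le> (B + 4 * k) * x powr (3 / 2)" if "x > 1 / 2 ^ n" for n x
    using that
  proof (induction n arbitrary: x)
    case 0
    then have "1 \<le> x powr (3 / 2)" using ge_one_powr_ge_zero[of x "3 / 2"] by simp
    then have "B * 1 \<le> (B + 4 * k) * x powr (3 / 2)"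
      using k B by (intro mult_mono) auto
    then show ?case using bound[of x] 0 by simp
  next
    case (Suc n)
    then have x: "x > 0" using less_trans[of 0 "1 / 2 ^ Suc n" x] by simp
    have "c (2 * x) \<le> (B + 4 * k) * (2 * x) powr (3 / 2)"
      using Suc.prems by (intro Suc.IH) (simp add: field_simps)
    also have "\<dots> = 2 powr (3 / 2) * ((B + 4 * k) * x powr (3 / 2))"
      by (simp add: powr_mult)
    \<comment> \<open>Together with the quarter in \<open>step\<close> this leaves the factor
      \<open>3 / 4\<close>; the spare quarter of \<open>B + 4 * k\<close> pays for the error
      \<open>k\<close>.\<close>
    also have "\<dots> \<le> 3 * ((B + 4 * k) * x powr (3 / 2))"
    proof (intro mult_right_mono mult_nonneg_nonneg)
      have "(2 powr (3 / 2)) ^ 2 = (2 :: real) powr 3"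
        by (simp add: powr_power)
      also have "\<dots> \<le> 3 ^ 2" by simp
      finally show "2 powr (3 / 2) \<le> (3 :: real)" by (rule power2_le_imp_le) simp
    qed (use k B in auto)
    finally have "c x \<le> 3 / 4 * ((B + 4 * k) * x powr (3 / 2)) + k * x powr (3 / 2)"
      using step[OF x] by simp
    also have "\<dots> \<le> (B + 4 * k) * x powr (3 / 2)"
      using B by (simp add: algebra_simps)
    finally show ?case .
  qed
  moreover obtain n where "x > 1 / 2 ^ n"
    using real_arch_pow_inv[of x "1 / 2"] x by (auto simp: power_one_over)
  ultimately show ?thesis by blast
qed

text \<open>At linear growth the halving of the value and the doubling of the scale cancel exactly,
  so no step gains a factor. The errors have to be summable by themselves, which holds because
  \<open>3 / 2\<close> exceeds \<open>1\<close>.\<close>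

lemma double_scale_linear_bound:
  fixes a :: "real \<Rightarrow> real"
  assumes step: "\<And>x. x > 0 \<Longrightarrow> a x \<le> a (2 * x) / 2 + k * x powr (3 / 2)"
    and bound: "\<And>x. x > 0 \<Longrightarrow> a x \<le> B"
    and k: "0 \<le> k" and B: "0 \<le> B" and x: "x > 0"
  shows "a x \<le> (B + 6 * k) * x"
proof -
  \<comment> \<open>The subtracted term absorbs the inhomogeneity of \<open>step\<close>, because \<open>2 powr (1/2) > 4/3\<close>.\<close>
  have main: "a x \<le> (B + 6 * k) * x - 3 * k * x powr (3 / 2)" if "x > 1 / 2 ^ n" "x \<le> 2" for n x
    using that
  proof (induction n arbitrary: x)
    case 0
    have "x powr (3 / 2) = x * x powr (1 / 2)"
      using 0 powr_add[of x 1 "1 / 2"] by simp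
    also have "\<dots> \<le> x * 2 powr 1"
      using 0 powr_mono2[of "1 / 2" x 2] powr_mono[of "1 / 2" 1 "2 :: real"] by (intro mult_left_mono) auto
    finally have "3 * k * x powr (3 / 2) \<le> 3 * k * (2 * x)"
      using k by (intro mult_left_mono) auto
    moreover have "B * 1 \<le> B * x" using 0 B by (intro mult_left_mono) auto
    ultimately show ?case using bound[of x] 0 by (simp add: algebra_simps)
  next
    case (Suc n)
    then have x: "x > 0" using less_trans[of 0 "1 / 2 ^ Suc n" x] by simp
    show ?case
    proof (cases "x > 1")
      case True
      then show ?thesis using Suc.IH[of x] Suc.prems
        by (smt (verit) divide_le_eq_1 one_le_power)
    next
      case False
      have "a (2 * x) \<le> (B + 6 * k) * (2 * x) - 3 * k * (2 * x) powr (3 / 2)"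
        using Suc.prems False by (intro Suc.IH) (simp_all add: field_simps)
      also have "(2 * x) powr (3 / 2) = 2 powr (3 / 2) * x powr (3 / 2)"
        by (simp add: powr_mult)
      finally have "a x \<le> (B + 6 * k) * x - 3 / 2 * k * (2 powr (3 / 2) * x powr (3 / 2)) + k * x powr (3 / 2)"
        using step[OF x] by (simp add: algebra_simps)
      \<comment> \<open>With \<open>8 / 3\<close> the coefficient becomes \<open>4 * k\<close>:
        \<open>3 * k\<close> restores the subtracted term and the remaining \<open>k\<close> cancels
        the error.\<close>
      moreover have "3 / 2 * k * (8 / 3 * x powr (3 / 2)) \<le> 3 / 2 * k * (2 powr (3 / 2) * x powr (3 / 2))"
      proof (intro mult_left_mono mult_right_mono)
        have "(8 / 3) ^ 2 \<le> (2 :: real) powr 3" by (simp add: power2_eq_square)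
        also have "\<dots> = (2 powr (3 / 2)) ^ 2" by (simp add: powr_power)
        finally show "8 / 3 \<le> (2 :: real) powr (3 / 2)" by (rule power2_le_imp_le) simp
      qed (use k in auto)
      ultimately show ?thesis by (simp add: algebra_simps)
    qed
  qed
  show ?thesis
  proof (cases "x \<le> 2")
    case True
    obtain n where "x > 1 / 2 ^ n"
      using real_arch_pow_inv[of x "1 / 2"] x by (auto simp: power_one_over)
    then have "a x \<le> (B + 6 * k) * x - 3 * k * x powr (3 / 2)"
      using main True by blast
    moreover have "0 \<le> 3 * k * x powr (3 / 2)" using k by simp
    ultimately show ?thesis by linarith
  next
    case False
    have "B * 1 \<le> (B + 6 * k) * x" using k B False by (intro mult_mono) auto
    then show ?thesis using bound[OF x] by simp
  qed
qed

section \<open>The spaces $L^p$\<close>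

text \<open>Real-valued, so that norms can be subtracted. A Bochner integral that does not exist has
  the value \<open>0\<close>, hence agreement with \<open>Lnorm\<close> is claimed only on
  \<open>Lp\<close>.\<close>

definition Lp_norm :: "'a measure \<Rightarrow> real \<Rightarrow> ('a \<Rightarrow> real) \<Rightarrow> real" where
  "Lp_norm M p f = (\<integral>x. \<bar>f x\<bar> powr p \<partial>M) powr (1 / p)"

lemma Lp_iff_integrable:
  assumes "1 \<le> p"
  shows "f \<in> Lp M (ennreal p) \<longleftrightarrow> f \<in> borel_measurable M \<and> integrable M (\<lambda>x. \<bar>f x\<bar> powr p)"
proof -
  have *: "ennroot p x < \<infinity> \<longleftrightarrow> x < \<infinity>" for x
    by (auto simp: ennroot_def less_top)
  show ?thesis
    using assms unfolding Lp_def Lnorm_def integrable_iff_bounded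
    by (simp add: * del: infinity_ennreal_def) auto
qed

lemma LpD:
  assumes "1 \<le> p" "f \<in> Lp M (ennreal p)"
  shows "f \<in> borel_measurable M" "integrable M (\<lambda>x. \<bar>f x\<bar> powr p)"
  using assms Lp_iff_integrable by auto

lemma Lnorm_eq_Lp_norm:
  assumes "1 \<le> p" "f \<in> Lp M (ennreal p)"
  shows "Lnorm M (ennreal p) f = ennreal (Lp_norm M p f)"
proof -
  have "(\<integral>\<^sup>+x. ennreal (\<bar>f x\<bar> powr p) \<partial>M) = ennreal (\<integral>x. \<bar>f x\<bar> powr p \<partial>M)"
    using LpD[OF assms] by (intro nn_integral_eq_integral) auto
  then show ?thesis
    using assms by (simp add: Lnorm_def ennroot_def Lp_norm_def)
qed

lemma Lp_norm_nonneg [simp]: "0 \<le> Lp_norm M p f"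
  by (simp add: Lp_norm_def)

lemma Lp_norm_powr: "p > 0 \<Longrightarrow> Lp_norm M p f powr p = (\<integral>x. \<bar>f x\<bar> powr p \<partial>M)"
  by (simp add: Lp_norm_def powr_powr)

lemma Lp_norm_le_iff:
  assumes "p > 0" "c \<ge> 0"
  shows "Lp_norm M p f \<le> c \<longleftrightarrow> (\<integral>x. \<bar>f x\<bar> powr p \<partial>M) \<le> c powr p"
proof
  assume "Lp_norm M p f \<le> c"
  then have "Lp_norm M p f powr p \<le> c powr p"
    using assms by (intro powr_mono2) auto
  then show "(\<integral>x. \<bar>f x\<bar> powr p \<partial>M) \<le> c powr p"
    using assms by (simp add: Lp_norm_powr)
next
  assume "(\<integral>x. \<bar>f x\<bar> powr p \<partial>M) \<le> c powr p"
  then have "Lp_norm M p f \<le> (c powr p) powr (1 / p)"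
    unfolding Lp_norm_def using assms by (intro powr_mono2) auto
  then show "Lp_norm M p f \<le> c"
    using assms by (simp add: powr_powr)
qed

lemma Lp_norm_cong_AE:
  assumes "AE x in M. f x = g x" and [measurable]: "f \<in> borel_measurable M" "g \<in> borel_measurable M"
  shows "Lp_norm M p f = Lp_norm M p g"
  unfolding Lp_norm_def by (intro arg_cong2[where f = "(powr)"] integral_cong_AE) (use assms in auto)

lemma Lp_norm_uminus [simp]: "Lp_norm M p (\<lambda>x. - f x) = Lp_norm M p f"
  by (simp add: Lp_norm_def)

lemma Lp_norm_mult:
  "Lp_norm M p (\<lambda>x. c * f x) = \<bar>c\<bar> * Lp_norm M p f" if "p > 0"
  using that by (simp add: Lp_norm_def abs_mult powr_mult powr_powr)

lemma Lp_mult: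
  "1 \<le> p \<Longrightarrow> f \<in> Lp M (ennreal p) \<Longrightarrow> (\<lambda>x. c * f x) \<in> Lp M (ennreal p)"
  by (auto simp: Lp_iff_integrable abs_mult powr_mult)

lemma Lp_bound:
  assumes "1 \<le> p" "g \<in> Lp M (ennreal p)" "f \<in> borel_measurable M" "AE x in M. \<bar>f x\<bar> \<le> \<bar>g x\<bar>"
  shows "f \<in> Lp M (ennreal p)"
proof -
  have "integrable M (\<lambda>x. \<bar>f x\<bar> powr p)"
    by (rule Bochner_Integration.integrable_bound[OF LpD(2)[OF assms(1,2)]])
       (use assms in \<open>auto elim!: eventually_mono intro!: powr_mono2\<close>)
  then show ?thesis using assms Lp_iff_integrable by blast
qed

text \<open>Dividing \<open>x + y\<close> by \<open>a + b\<close> gives a convex combination of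
  \<open>x / a\<close> and \<open>y / b\<close>. This is the pointwise form of Minkowski's
  inequality, with \<open>a\<close> and \<open>b\<close> in the place of the norms.\<close>

lemma powr_convex_combination:
  fixes a b x y p :: real
  assumes "1 \<le> p" "0 < a" "0 < b" "0 \<le> x" "0 \<le> y"
  shows "(x + y) powr p \<le> (a + b) powr p * (a / (a + b) * (x powr p / a powr p) + b / (a + b) * (y powr p / b powr p))"
proof (cases "x = 0 \<or> y = 0")
  case True
  have *: "z powr p \<le> (a + b) powr p * (c / (a + b) * (z powr p / c powr p))"
    if "c = a \<or> c = b" "z \<ge> 0" for c z
  proof -
    have c: "0 < c" "c \<le> a + b" using that assms by auto
    have "c powr (p - 1) \<le> (a + b) powr (p - 1)"
      using assms c by (intro powr_mono2) auto
    then have "z powr p * 1 \<le> z powr p * ((a + b) powr (p - 1) / c powr (p - 1))"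
      using c by (intro mult_left_mono) auto
    also have "\<dots> = (a + b) powr p * (c / (a + b) * (z powr p / c powr p))"
      using c assms by (simp add: powr_diff)
    finally show ?thesis by simp
  qed
  show ?thesis using True *[of a x] *[of b y] assms by auto
next
  case False
  then have "convex_on {0<..} (\<lambda>x. x powr p)" "x > 0" "y > 0"
    using assms powr_convex by auto
  then have "((1 - b / (a + b)) * (x / a) + b / (a + b) * (y / b)) powr p
      \<le> (1 - b / (a + b)) * (x / a) powr p + b / (a + b) * (y / b) powr p"
    using convex_onD[of "{0<..}" "\<lambda>x. x powr p" "b / (a + b)" "x / a" "y / b"] assms by simp
  moreover have "1 - b / (a + b) = a / (a + b)"
    using assms by (simp add: field_simps)
  moreover have "a / (a + b) * (x / a) + b / (a + b) * (y / b) = (x + y) / (a + b)"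
    using assms by (simp add: add_divide_distrib)
  ultimately have "((x + y) / (a + b)) powr p
      \<le> a / (a + b) * (x powr p / a powr p) + b / (a + b) * (y powr p / b powr p)"
    using assms by (simp add: powr_divide)
  then have "(a + b) powr p * ((x + y) / (a + b)) powr p
      \<le> (a + b) powr p * (a / (a + b) * (x powr p / a powr p) + b / (a + b) * (y powr p / b powr p))"
    by (intro mult_left_mono) auto
  then show ?thesis using assms by (simp add: powr_divide)
qed

lemma
  assumes p: "1 \<le> p" and f: "f \<in> Lp M (ennreal p)" and g: "g \<in> Lp M (ennreal p)"
  shows Lp_add: "(\<lambda>x. f x + g x) \<in> Lp M (ennreal p)"
    and Lp_norm_triangle: "Lp_norm M p (\<lambda>x. f x + g x) \<le> Lp_norm M p f + Lp_norm M p g"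
proof -
  note [measurable] = LpD(1)[OF p f] LpD(1)[OF p g]
  note int [simp] = LpD(2)[OF p f] LpD(2)[OF p g]
  have bound: "\<bar>f x + g x\<bar> powr p
      \<le> (a + b) powr p * (a / (a + b) * (\<bar>f x\<bar> powr p / a powr p) + b / (a + b) * (\<bar>g x\<bar> powr p / b powr p))"
    if "a > 0" "b > 0" for a b x
    using powr_convex_combination[of p a b "\<bar>f x\<bar>" "\<bar>g x\<bar>"] p that
    by (smt (verit) powr_mono2 abs_ge_zero abs_triangle_ineq)
  \<comment> \<open>For integrability alone the weights \<open>a = b = 1\<close> are enough.\<close>
  have int_add: "integrable M (\<lambda>x. \<bar>f x + g x\<bar> powr p)"
    by (rule Bochner_Integration.integrable_bound[where f = "\<lambda>x. (1 + 1) powr p * (1 / (1 + 1) * (\<bar>f x\<bar> powr p / 1 powr p) + 1 / (1 + 1) * (\<bar>g x\<bar> powr p / 1 powr p))"])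
       (use bound[of 1 1] in auto)
  then show "(\<lambda>x. f x + g x) \<in> Lp M (ennreal p)"
    using p by (simp add: Lp_iff_integrable)
  show "Lp_norm M p (\<lambda>x. f x + g x) \<le> Lp_norm M p f + Lp_norm M p g"
  proof (rule field_le_epsilon)
    fix e :: real assume e: "e > 0"
    \<comment> \<open>The slack keeps both weights positive even if a norm vanishes.\<close>
    define a where "a = Lp_norm M p f + e / 2"
    define b where "b = Lp_norm M p g + e / 2"
    have ab: "a > 0" "b > 0" using e Lp_norm_nonneg[of M p f] Lp_norm_nonneg[of M p g]
      unfolding a_def b_def by linarith+
    have le: "(\<integral>x. \<bar>f x\<bar> powr p \<partial>M) \<le> a powr p" "(\<integral>x. \<bar>g x\<bar> powr p \<partial>M) \<le> b powr p"
      using p e ab by (auto simp: Lp_norm_le_iff[symmetric] a_def b_def)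
    have "(\<integral>x. \<bar>f x + g x\<bar> powr p \<partial>M)
        \<le> (\<integral>x. (a + b) powr p * (a / (a + b) * (\<bar>f x\<bar> powr p / a powr p) + b / (a + b) * (\<bar>g x\<bar> powr p / b powr p)) \<partial>M)"
      by (intro integral_mono int_add bound ab) auto
    also have "\<dots> = (a + b) powr p * (a / (a + b) * ((\<integral>x. \<bar>f x\<bar> powr p \<partial>M) / a powr p)
        + b / (a + b) * ((\<integral>x. \<bar>g x\<bar> powr p \<partial>M) / b powr p))"
      by simp
    also have "\<dots> \<le> (a + b) powr p * (a / (a + b) * 1 + b / (a + b) * 1)"
      using ab le by (intro mult_left_mono add_mono) auto
    also have "\<dots> = (a + b) powr p"
      using ab by (simp add: add_divide_distrib[symmetric])
    finally have "Lp_norm M p (\<lambda>x. f x + g x) \<le> a + b"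
      using ab p by (simp add: Lp_norm_le_iff)
    then show "Lp_norm M p (\<lambda>x. f x + g x) \<le> Lp_norm M p f + Lp_norm M p g + e"
      by (simp add: a_def b_def)
  qed
qed

lemma
  assumes p: "1 \<le> p" and f: "f \<in> Lp M (ennreal p)" and g: "g \<in> Lp M (ennreal p)"
  shows Lp_diff: "(\<lambda>x. f x - g x) \<in> Lp M (ennreal p)"
    and Lp_norm_triangle_diff: "Lp_norm M p (\<lambda>x. f x - g x) \<le> Lp_norm M p f + Lp_norm M p g"
  using Lp_add[OF p f Lp_mult[OF p g, of "-1"]] Lp_norm_triangle[OF p f Lp_mult[OF p g, of "-1"]]
  by simp_all

section \<open>Conjugate exponents, the duality map and truncation\<close>

lemma mult_le_powr_conjugate:
  fixes x y p q :: real
  assumes "1 < p" "q = p / (p - 1)" "0 \<le> x" "0 \<le> y"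
  shows "x * y \<le> x powr p + y powr q"
proof -
  have pq: "1 / p + 1 / q = 1" "q > 1" using assms(1) by (auto simp: assms(2) field_simps)
  have "x * y \<le> x powr p / p + y powr q / q"
    using Youngs_inequality[of p q x y] assms pq by simp
  also have "\<dots> \<le> x powr p / 1 + y powr q / 1"
    using assms pq by (intro add_mono divide_left_mono) auto
  finally show ?thesis by simp
qed

lemma Lp_mult_integrable:
  assumes "1 < p" "q = p / (p - 1)" and f: "f \<in> Lp M (ennreal p)" and g: "g \<in> Lp M (ennreal q)"
  shows "integrable M (\<lambda>x. f x * g x)"
proof -
  have pq: "1 \<le> p" "1 \<le> q" using assms(1) by (auto simp: assms(2))
  note [measurable] = LpD(1)[OF pq(1) f] LpD(1)[OF pq(2) g]
  show ?thesis
    by (rule Bochner_Integration.integrable_bound[where f = "\<lambda>x. \<bar>f x\<bar> powr p + \<bar>g x\<bar> powr q"])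
       (use LpD(2)[OF pq(1) f] LpD(2)[OF pq(2) g] mult_le_powr_conjugate[OF assms(1,2)]
         in \<open>auto simp: abs_mult\<close>)
qed

lemma signed_powr_mult_self: "p > 1 \<Longrightarrow> v * signed_powr (p - 1) v = \<bar>v\<bar> powr p"
  using powr_minus_one_mult[of "\<bar>v\<bar>" p]
  by (cases v "0 :: real" rule: linorder_cases) (simp_all add: signed_powr_def mult_ac)

lemma abs_signed_powr: "\<bar>signed_powr a v\<bar> = \<bar>v\<bar> powr a" if "a \<noteq> 0"
  using that by (cases "v = 0") (simp_all add: signed_powr_def abs_mult abs_sgn_eq)

lemma measurable_signed_powr [measurable]:
  assumes [measurable]: "f \<in> borel_measurable M"
  shows "(\<lambda>x. signed_powr a (f x)) \<in> borel_measurable M"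
  unfolding signed_powr_def by measurable

text \<open>This is the duality map: since \<open>(p - 1) * q = p\<close>, the q-th power of the
  image is the p-th power of \<open>f\<close>.\<close>

lemma Lp_signed_powr:
  assumes "1 < p" "q = p / (p - 1)" and f: "f \<in> Lp M (ennreal p)"
  shows "(\<lambda>x. signed_powr (p - 1) (f x)) \<in> Lp M (ennreal q)"
proof -
  have q: "1 \<le> q" using assms(1) by (simp add: assms(2))
  have pq: "(p - 1) * q = p" using assms(1) by (simp add: assms(2))
  have [measurable]: "f \<in> borel_measurable M" and "integrable M (\<lambda>x. \<bar>f x\<bar> powr p)"
    using LpD[OF _ f] assms(1) by auto
  then show ?thesis
    unfolding Lp_iff_integrable[OF q] using assms(1)
    by (simp add: abs_signed_powr powr_powr pq)
qed

text \<open>Membership in \<open>Lp M 2\<close> requires cutting large values for exponents below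
  \<open>2\<close> and small values for exponents above \<open>2\<close>. Symmetry concerns a
  conjugate pair, so both cuts are made.\<close>

definition truncate_fun :: "nat \<Rightarrow> ('a \<Rightarrow> real) \<Rightarrow> 'a \<Rightarrow> real" where
  "truncate_fun n f x = (if 1 / (real n + 1) < \<bar>f x\<bar> \<and> \<bar>f x\<bar> \<le> real n + 1 then f x else 0)"

lemma measurable_truncate_fun [measurable]:
  assumes [measurable]: "f \<in> borel_measurable M"
  shows "truncate_fun n f \<in> borel_measurable M"
  unfolding truncate_fun_def[abs_def] by measurable

lemma abs_truncate_fun_le: "\<bar>truncate_fun n f x\<bar> \<le> \<bar>f x\<bar>"
  by (simp add: truncate_fun_def)

lemma truncate_fun_tendsto: "(\<lambda>n. truncate_fun n f x) \<longlonglongrightarrow> f x"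
proof (cases "f x = 0")
  case True
  then show ?thesis by (simp add: truncate_fun_def)
next
  case False
  have "(\<lambda>n. 1 / (real n + 1)) \<longlonglongrightarrow> 0" by real_asymp
  then have "eventually (\<lambda>n. 1 / (real n + 1) < \<bar>f x\<bar>) sequentially"
    using False by (simp add: order_tendstoD(2))
  moreover have "eventually (\<lambda>n. \<bar>f x\<bar> \<le> real n + 1) sequentially"
    by real_asymp
  ultimately have "eventually (\<lambda>n. truncate_fun n f x = f x) sequentially"
    by eventually_elim (simp add: truncate_fun_def)
  then show ?thesis by (rule tendsto_eventually)
qed

text \<open>On the support \<open>1 \<le> m * \<bar>f x\<bar>\<close> with
  \<open>m = real n + 1\<close>. The factor \<open>m powr p * \<bar>f x\<bar> powr p\<close> is thus
  at least \<open>1\<close> there, and it makes the constant bound on the square integrable.\<close>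

lemma
  assumes p: "1 \<le> p" and f: "f \<in> Lp M (ennreal p)"
  shows Lp_truncate_fun: "truncate_fun n f \<in> Lp M (ennreal p)"
    and L2_truncate_fun: "truncate_fun n f \<in> Lp M 2"
proof -
  note [measurable] = LpD(1)[OF p f]
  show "truncate_fun n f \<in> Lp M (ennreal p)"
    by (rule Lp_bound[OF p f]) (auto simp: abs_truncate_fun_le)
  define m where "m = real n + 1"
  have m: "m \<ge> 1" by (simp add: m_def)
  have bound: "\<bar>truncate_fun n f x\<bar> powr 2 \<le> m\<^sup>2 * m powr p * \<bar>f x\<bar> powr p" for x
  proof (cases "1 / m < \<bar>f x\<bar> \<and> \<bar>f x\<bar> \<le> m")
    case True
    then have "1 \<le> m * \<bar>f x\<bar>" using m by (simp add: field_simps)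
    then have "1 powr p \<le> (m * \<bar>f x\<bar>) powr p" using p by (intro powr_mono2) auto
    then have "1 \<le> m powr p * \<bar>f x\<bar> powr p" by (simp add: powr_mult)
    moreover have "(f x)\<^sup>2 \<le> m\<^sup>2" using True m by (simp add: abs_le_square_iff[symmetric])
    ultimately have "(f x)\<^sup>2 * 1 \<le> m\<^sup>2 * (m powr p * \<bar>f x\<bar> powr p)"
      by (intro mult_mono) auto
    then show ?thesis using True by (simp add: truncate_fun_def m_def mult_ac)
  next
    case False
    then have "truncate_fun n f x = 0" by (auto simp: truncate_fun_def m_def)
    then show ?thesis by simp
  qed
  have "integrable M (\<lambda>x. \<bar>truncate_fun n f x\<bar> powr 2)"
  proof (rule Bochner_Integration.integrable_bound)
    show "integrable M (\<lambda>x. m\<^sup>2 * m powr p * \<bar>f x\<bar> powr p)"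
      by (intro integrable_mult_right LpD(2)[OF p f])
    show "AE x in M. norm (\<bar>truncate_fun n f x\<bar> powr 2) \<le> norm (m\<^sup>2 * m powr p * \<bar>f x\<bar> powr p)"
      using bound by (intro AE_I2) (simp del: powr_numeral)
  qed measurable
  then show "truncate_fun n f \<in> Lp M 2"
    using Lp_iff_integrable[of 2 "truncate_fun n f" M] by simp
qed

lemma L1_iff_integrable: "f \<in> Lp M 1 \<longleftrightarrow> integrable M f"
proof -
  have "f \<in> Lp M 1 \<longleftrightarrow> f \<in> borel_measurable M \<and> integrable M (\<lambda>x. \<bar>f x\<bar>)"
    using Lp_iff_integrable[of 1 f M] by simp
  then show ?thesis using integrable_abs_iff borel_measurable_integrable by blast
qed

section \<open>Symmetric conservative semigroups\<close>

locale markov_semigroup =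
  fixes M :: "'a measure" and P :: "real \<Rightarrow> ('a \<Rightarrow> real) \<Rightarrow> 'a \<Rightarrow> real"
    and K :: "real \<Rightarrow> 'a \<Rightarrow> 'a measure"
  assumes contraction_semigroup: "1 \<le> q \<Longrightarrow> positive_contraction_semigroup M P q"
    and L2_symmetric: "\<lbrakk>0 \<le> t; f \<in> Lp M 2; g \<in> Lp M 2\<rbrakk> \<Longrightarrow> L2_inner M (P t f) g = L2_inner M f (P t g)"
    and kernel: "heat_kernel_measures M P K"
    and conservative: "conservative M P"
begin

section \<open>Calculus of \<open>P t\<close> on one space of the scale\<close>

context
  fixes p t :: real
  assumes p: "1 \<le> p" and t: "0 \<le> t"
begin

lemma semigroup_p: "positive_contraction_semigroup M P (ennreal p)"
  using p by (intro contraction_semigroup) simp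

lemma P_Lp: "f \<in> Lp M (ennreal p) \<Longrightarrow> P t f \<in> Lp M (ennreal p)"
  using semigroup_p t by (auto simp: positive_contraction_semigroup_def)

lemma P_contraction:
  assumes "f \<in> Lp M (ennreal p)"
  shows "Lp_norm M p (P t f) \<le> Lp_norm M p f"
proof -
  have "Lnorm M (ennreal p) (P t f) \<le> Lnorm M (ennreal p) f"
    using semigroup_p t assms by (auto simp: positive_contraction_semigroup_def)
  then show ?thesis
    using assms P_Lp p by (simp add: Lnorm_eq_Lp_norm)
qed

lemma P_linear:
  assumes "f \<in> Lp M (ennreal p)" "g \<in> Lp M (ennreal p)"
  shows "AE x in M. P t (\<lambda>y. a * f y + b * g y) x = a * P t f x + b * P t g x"
proof -
  have "\<forall>t\<ge>0. \<forall>f\<in>Lp M (ennreal p). \<forall>g\<in>Lp M (ennreal p). \<forall>a b.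
      AE x in M. P t (\<lambda>y. a * f y + b * g y) x = a * P t f x + b * P t g x"
    using semigroup_p unfolding positive_contraction_semigroup_def by (elim conjE)
  then show ?thesis using t assms by simp
qed

lemma P_diff:
  assumes "f \<in> Lp M (ennreal p)" "g \<in> Lp M (ennreal p)"
  shows "AE x in M. P t (\<lambda>y. f y - g y) x = P t f x - P t g x"
  using P_linear[OF assms, of 1 "-1"] by simp

lemma P_nonneg:
  "f \<in> Lp M (ennreal p) \<Longrightarrow> AE x in M. 0 \<le> f x \<Longrightarrow> AE x in M. 0 \<le> P t f x"
  using semigroup_p t unfolding positive_contraction_semigroup_def by blast

lemma P_mono:
  assumes "f \<in> Lp M (ennreal p)" "g \<in> Lp M (ennreal p)" "AE x in M. f x \<le> g x"
  shows "AE x in M. P t f x \<le> P t g x"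
  using P_nonneg[OF Lp_diff[OF p assms(2,1)]] P_diff[OF assms(2,1)] assms(3) by auto

text \<open>Functions are representatives here, so independence of the representative must be
  derived; order preservation in both directions yields it.\<close>

lemma P_cong_AE:
  assumes "f \<in> Lp M (ennreal p)" "g \<in> Lp M (ennreal p)" "AE x in M. f x = g x"
  shows "AE x in M. P t f x = P t g x"
proof -
  have "AE x in M. f x \<le> g x" "AE x in M. g x \<le> f x" using assms(3) by auto
  then have "AE x in M. P t f x \<le> P t g x" "AE x in M. P t g x \<le> P t f x"
    using P_mono assms(1,2) by blast+
  then show ?thesis by eventually_elim simp
qed

lemma P_add_time:
  "0 \<le> s \<Longrightarrow> f \<in> Lp M (ennreal p) \<Longrightarrow> AE x in M. P (t + s) f x = P t (P s f) x"
  using semigroup_p t unfolding positive_contraction_semigroup_def by blast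

lemma P_eq_kernel:
  assumes "0 < t" "f \<in> Lp M (ennreal p)"
  shows "AE y in M. integrable (K t y) f \<and> P t f y = (\<integral>x. f x \<partial>K t y)"
proof -
  have "1 \<le> ennreal p" using p by simp
  then show ?thesis using kernel assms unfolding heat_kernel_measures_def by blast
qed

end

lemma
  assumes t: "0 \<le> t" and f: "integrable M f"
  shows integrable_P: "integrable M (P t f)"
    and integral_P_le: "(AE x in M. 0 \<le> f x) \<Longrightarrow> (\<integral>x. P t f x \<partial>M) \<le> (\<integral>x. f x \<partial>M)"
proof -
  have f1: "f \<in> Lp M (ennreal 1)" using f by (simp add: L1_iff_integrable)
  show *: "integrable M (P t f)"
    using P_Lp[OF order_refl t f1] by (simp add: L1_iff_integrable)
  assume nn: "AE x in M. 0 \<le> f x"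
  have "Lp_norm M 1 g = (\<integral>x. g x \<partial>M)" if "integrable M g" "AE x in M. 0 \<le> g x" for g
  proof -
    have "Lp_norm M 1 g = (\<integral>x. \<bar>g x\<bar> \<partial>M)" by (simp add: Lp_norm_def)
    also have "\<dots> = (\<integral>x. g x \<partial>M)" using that by (intro integral_cong_AE) auto
    finally show ?thesis .
  qed
  then show "(\<integral>x. P t f x \<partial>M) \<le> (\<integral>x. f x \<partial>M)"
    using P_contraction[OF order_refl t f1] P_nonneg[OF order_refl t f1 nn] nn f * by simp
qed

text \<open>
  The functional \<open>f \<mapsto> \<integral> (f - P t f)\<close> would vanish identically if \<open>M\<close> were \<open>\<sigma>\<close>-finite.
  In general mass may escape to a part of the space that no function in \<open>L\<^sup>1\<close> sees,
  and only its monotonicity is available.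
\<close>

lemma integral_P_defect_mono:
  assumes t: "0 \<le> t" and f: "integrable M f" and g: "integrable M g" and le: "AE x in M. f x \<le> g x"
  shows "(\<integral>x. f x \<partial>M) - (\<integral>x. P t f x \<partial>M) \<le> (\<integral>x. g x \<partial>M) - (\<integral>x. P t g x \<partial>M)"
proof -
  have fg: "integrable M (\<lambda>x. g x - f x)" using f g by simp
  have "(\<integral>x. P t (\<lambda>x. g x - f x) x \<partial>M) \<le> (\<integral>x. g x - f x \<partial>M)"
    by (rule integral_P_le[OF t fg]) (use le in auto)
  moreover have "(\<integral>x. P t (\<lambda>x. g x - f x) x \<partial>M) = (\<integral>x. P t g x - P t f x \<partial>M)"
    using P_diff[OF order_refl t, of g f] integrable_P[OF t] f g fg
    by (intro integral_cong_AE borel_measurable_integrable Bochner_Integration.integrable_diff)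
       (auto simp: L1_iff_integrable)
  ultimately show ?thesis
    using f g integrable_P[OF t f] integrable_P[OF t g] by simp
qed

text \<open>The constant \<open>1\<close> lies in \<open>Lp M \<infinity>\<close>, where the kernel
  also represents \<open>P t\<close>, so conservativity says that the kernel has total mass
  \<open>1\<close>.\<close>

lemma prob_space_kernel:
  assumes "0 < t"
  shows "AE y in M. prob_space (K t y)"
proof -
  have "esssup M (\<lambda>x. ennreal \<bar>1\<bar>) \<le> 1"
    by (rule esssup_I) simp_all
  also have "(1 :: ennreal) < \<infinity>" by simp
  finally have "(\<lambda>_. 1) \<in> Lp M \<infinity>"
    by (simp add: Lp_def Lnorm_def)
  moreover have "(1 :: ennreal) \<le> \<infinity>" by simp
  ultimately have "AE y in M. integrable (K t y) (\<lambda>_. 1 :: real) \<and> P t (\<lambda>_. 1) y = (\<integral>x. 1 \<partial>K t y)"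
    using kernel assms unfolding heat_kernel_measures_def by blast
  moreover have "AE y in M. P t (\<lambda>_. 1) y = 1"
    using conservative assms by (simp add: conservative_def)
  ultimately show ?thesis
  proof eventually_elim
    case (elim y)
    then have "measure (K t y) (space (K t y)) = 1" by simp
    \<comment> \<open>Since \<open>measure\<close> is \<open>0\<close> on sets of infinite mass, the
      value \<open>1\<close> determines \<open>emeasure\<close>.\<close>
    then have "emeasure (K t y) (space (K t y)) = ennreal 1"
      using emeasure_eq_ennreal_measure[of "K t y" "space (K t y)"] measure_zero_top[of "K t y" "space (K t y)"]
      by auto
    then show ?case by (intro prob_spaceI) simp
  qed
qed

section \<open>Symmetry between conjugate exponents and deviation under the kernel\<close>

lemma sets_kernel_eq: "0 < t \<Longrightarrow> y \<in> space M \<Longrightarrow> sets (K t y) = sets M"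
  using kernel unfolding heat_kernel_measures_def by (metis sets_kernel)

lemma measurable_kernel:
  "0 < t \<Longrightarrow> y \<in> space M \<Longrightarrow> f \<in> borel_measurable M \<Longrightarrow> f \<in> borel_measurable (K t y)"
  by (subst measurable_cong_sets[OF sets_kernel_eq refl])

text \<open>Dominated convergence under each \<open>K t y\<close>. Countably many truncations share
  one exceptional null set.\<close>

lemma P_truncate_fun:
  assumes p: "1 \<le> p" and t: "0 < t" and f: "f \<in> Lp M (ennreal p)"
  shows "AE y in M. (\<forall>n. \<bar>P t (truncate_fun n f) y\<bar> \<le> P t (\<lambda>x. \<bar>f x\<bar>) y)
    \<and> (\<lambda>n. P t (truncate_fun n f) y) \<longlonglongrightarrow> P t f y"
proof -
  have af: "(\<lambda>x. \<bar>f x\<bar>) \<in> Lp M (ennreal p)"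
    using LpD(1)[OF p f] by (intro Lp_bound[OF p f]) auto
  have "AE y in M. \<forall>n. integrable (K t y) (truncate_fun n f)
      \<and> P t (truncate_fun n f) y = (\<integral>x. truncate_fun n f x \<partial>K t y)"
    unfolding AE_all_countable using P_eq_kernel[OF p _ t Lp_truncate_fun[OF p f]] t by simp
  moreover have "AE y in M. integrable (K t y) (\<lambda>x. \<bar>f x\<bar>)
      \<and> P t (\<lambda>x. \<bar>f x\<bar>) y = (\<integral>x. \<bar>f x\<bar> \<partial>K t y)"
    using P_eq_kernel[OF p _ t af] t by simp
  moreover have "AE y in M. integrable (K t y) f \<and> P t f y = (\<integral>x. f x \<partial>K t y)"
    using P_eq_kernel[OF p _ t f] t by simp
  ultimately show ?thesis
  proof eventually_elim
    case (elim y)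
    have "\<bar>P t (truncate_fun n f) y\<bar> \<le> P t (\<lambda>x. \<bar>f x\<bar>) y" for n
    proof -
      have "\<bar>\<integral>x. truncate_fun n f x \<partial>K t y\<bar> \<le> (\<integral>x. \<bar>truncate_fun n f x\<bar> \<partial>K t y)"
        by (rule integral_abs_bound)
      also have "\<dots> \<le> (\<integral>x. \<bar>f x\<bar> \<partial>K t y)"
        using elim by (intro integral_mono) (auto simp: abs_truncate_fun_le)
      finally show ?thesis using elim by simp
    qed
    moreover have "(\<lambda>n. \<integral>x. truncate_fun n f x \<partial>K t y) \<longlonglongrightarrow> (\<integral>x. f x \<partial>K t y)"
      by (rule integral_dominated_convergence[where w = "\<lambda>x. \<bar>f x\<bar>"])
         (use elim in \<open>auto simp: abs_truncate_fun_le truncate_fun_tendsto\<close>)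
    ultimately show ?case using elim by simp
  qed
qed

text \<open>Both factors are truncated so that the sequence consists of pairings in
  \<open>Lp M 2\<close>, where symmetry is given. The majorant is a product of functions with
  conjugate exponents.\<close>

lemma integral_P_truncate_fun_tendsto:
  assumes pq: "1 < p" "q = p / (p - 1)" and t: "0 < t"
    and f: "f \<in> Lp M (ennreal p)" and g: "g \<in> Lp M (ennreal q)"
  shows "(\<lambda>n. \<integral>x. P t (truncate_fun n f) x * truncate_fun n g x \<partial>M)
    \<longlonglongrightarrow> (\<integral>x. P t f x * g x \<partial>M)"
proof -
  have p: "1 \<le> p" and q: "1 \<le> q" using pq(1) by (auto simp: pq(2))
  have t0: "0 \<le> t" using t by simp
  note [measurable] = LpD(1)[OF p f] LpD(1)[OF q g]
  have af: "(\<lambda>x. \<bar>f x\<bar>) \<in> Lp M (ennreal p)" by (intro Lp_bound[OF p f]) auto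
  have ag: "(\<lambda>x. \<bar>g x\<bar>) \<in> Lp M (ennreal q)" by (intro Lp_bound[OF q g]) auto
  have [measurable]: "P t f \<in> borel_measurable M" "P t (truncate_fun n f) \<in> borel_measurable M" for n
    using LpD(1)[OF p P_Lp[OF p t0]] f Lp_truncate_fun[OF p f] by auto
  show ?thesis
  proof (rule integral_dominated_convergence)
    show "integrable M (\<lambda>x. P t (\<lambda>x. \<bar>f x\<bar>) x * \<bar>g x\<bar>)"
      by (rule Lp_mult_integrable[OF pq P_Lp[OF p t0 af] ag])
    show "AE x in M. (\<lambda>n. P t (truncate_fun n f) x * truncate_fun n g x) \<longlonglongrightarrow> P t f x * g x"
      using P_truncate_fun[OF p t f]
      by eventually_elim (auto intro!: tendsto_mult truncate_fun_tendsto)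
    show "AE x in M. norm (P t (truncate_fun n f) x * truncate_fun n g x) \<le> P t (\<lambda>x. \<bar>f x\<bar>) x * \<bar>g x\<bar>" for n
      using P_truncate_fun[OF p t f]
    proof eventually_elim
      case (elim x)
      have "0 \<le> P t (\<lambda>x. \<bar>f x\<bar>) x"
        using elim abs_ge_zero order_trans by blast
      then show ?case using elim abs_truncate_fun_le[of n g x]
        unfolding real_norm_def abs_mult by (intro mult_mono) auto
    qed
  qed measurable
qed

text \<open>Both sides are limits of the same sequence of pairings in \<open>Lp M 2\<close>; the
  second limit is the first with the roles of \<open>f\<close>, \<open>p\<close> and
  \<open>g\<close>, \<open>q\<close> exchanged.\<close>

lemma P_symmetric:
  assumes pq: "1 < p" "q = p / (p - 1)" and t: "0 < t"
    and f: "f \<in> Lp M (ennreal p)" and g: "g \<in> Lp M (ennreal q)"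
  shows "(\<integral>x. P t f x * g x \<partial>M) = (\<integral>x. f x * P t g x \<partial>M)"
proof (rule LIMSEQ_unique)
  have p: "1 \<le> p" and q: "1 \<le> q" "1 < q" using pq(1) by (auto simp: pq(2))
  have qp: "p = q / (q - 1)" using pq(1) by (simp add: pq(2) field_simps)
  show "(\<lambda>n. \<integral>x. P t (truncate_fun n f) x * truncate_fun n g x \<partial>M) \<longlonglongrightarrow> (\<integral>x. P t f x * g x \<partial>M)"
    by (rule integral_P_truncate_fun_tendsto[OF pq t f g])
  have "(\<lambda>n. \<integral>x. P t (truncate_fun n g) x * truncate_fun n f x \<partial>M) \<longlonglongrightarrow> (\<integral>x. P t g x * f x \<partial>M)"
    by (rule integral_P_truncate_fun_tendsto[OF q(2) qp t g f])
  moreover have "(\<integral>x. P t (truncate_fun n g) x * truncate_fun n f x \<partial>M)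
      = (\<integral>x. P t (truncate_fun n f) x * truncate_fun n g x \<partial>M)" for n
    using L2_symmetric[OF _ L2_truncate_fun[OF p f] L2_truncate_fun[OF q(1) g], of t n n] t
    by (simp add: L2_inner_def mult.commute)
  ultimately show "(\<lambda>n. \<integral>x. P t (truncate_fun n f) x * truncate_fun n g x \<partial>M)
      \<longlonglongrightarrow> (\<integral>x. f x * P t g x \<partial>M)"
    by (simp add: mult.commute)
qed

text \<open>The bound of \<open>powr_diff_le_bregman\<close> averaged over the kernel at
  \<open>y\<close>, with \<open>P t f y\<close> for \<open>b\<close>. The first bracket is the gap
  in Jensen's inequality.\<close>

definition deviation_bound :: "real \<Rightarrow> real \<Rightarrow> real \<Rightarrow> ('a \<Rightarrow> real) \<Rightarrow> 'a \<Rightarrow> real" where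
  "deviation_bound p t e f y =
     2 / (p - 1) * e powr (p - 2) * (P t (\<lambda>x. \<bar>f x\<bar> powr p) y - \<bar>P t f y\<bar> powr p)
     + 2 * e powr p * (P t (\<lambda>x. \<bar>f x\<bar> powr p) y + \<bar>P t f y\<bar> powr p)"

text \<open>Under the probability measure \<open>K t y\<close> the function \<open>f\<close> has
  mean \<open>P t f y\<close>, so the linear term of the divergence integrates to zero.\<close>

lemma kernel_deviation:
  assumes p: "1 < p" "p \<le> 2" and t: "0 < t" and e: "0 < e" and f: "f \<in> Lp M (ennreal p)"
  shows "AE y in M. integrable (K t y) (\<lambda>x. \<bar>f x - P t f y\<bar> powr p)
    \<and> (\<integral>x. \<bar>f x - P t f y\<bar> powr p \<partial>K t y) \<le> deviation_bound p t e f y"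
proof -
  have p1: "1 \<le> p" using p by simp
  have fp: "(\<lambda>x. \<bar>f x\<bar> powr p) \<in> Lp M (ennreal 1)"
    using LpD(2)[OF p1 f] by (simp add: L1_iff_integrable)
  have "AE y in M. integrable (K t y) (\<lambda>x. \<bar>f x\<bar> powr p)
      \<and> P t (\<lambda>x. \<bar>f x\<bar> powr p) y = (\<integral>x. \<bar>f x\<bar> powr p \<partial>K t y)"
    using P_eq_kernel[OF _ _ t fp] t by simp
  moreover have "AE y in M. integrable (K t y) f \<and> P t f y = (\<integral>x. f x \<partial>K t y)"
    using P_eq_kernel[OF p1 _ t f] t by simp
  ultimately show ?thesis
    using prob_space_kernel[OF t] AE_space
  proof eventually_elim
    case (elim y)
    interpret prob_space "K t y" by fact
    note [measurable] = measurable_kernel[OF t elim(4) LpD(1)[OF p1 f]]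
    have int: "integrable (K t y) f" "integrable (K t y) (\<lambda>x. \<bar>f x\<bar> powr p)" using elim by auto
    define c where "c = P t f y"
    have c: "c = (\<integral>x. f x \<partial>K t y)" using elim by (simp add: c_def)
    define A where "A = 2 / (p - 1) * e powr (p - 2)"
    define B where "B = 2 * e powr p"
    define d where "d = p * signed_powr (p - 1) c"
    let ?R = "\<lambda>x. A * (\<bar>f x\<bar> powr p - \<bar>c\<bar> powr p - d * (f x - c)) + B * (\<bar>f x\<bar> powr p + \<bar>c\<bar> powr p)"
    have le: "\<bar>f x - c\<bar> powr p \<le> ?R x" for x
      using powr_diff_le_bregman[OF p e, of "f x" c] by (simp only: powr_bregman_def A_def B_def d_def)
    have R: "integrable (K t y) ?R"
      using int by (intro Bochner_Integration.integrable_add Bochner_Integration.integrable_diff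
          integrable_mult_right integrable_const)
    have I: "integrable (K t y) (\<lambda>x. \<bar>f x - c\<bar> powr p)"
    proof (rule Bochner_Integration.integrable_bound[OF R])
      have "norm (\<bar>f x - c\<bar> powr p) \<le> norm (?R x)" for x
        using order_trans[OF le[of x] abs_ge_self] by simp
      then show "AE x in K t y. norm (\<bar>f x - c\<bar> powr p) \<le> norm (?R x)" by simp
    qed measurable
    have "(\<integral>x. \<bar>f x - c\<bar> powr p \<partial>K t y) \<le> (\<integral>x. ?R x \<partial>K t y)"
      by (intro integral_mono I R le)
    also have "\<dots> = A * ((\<integral>x. \<bar>f x\<bar> powr p \<partial>K t y) - \<bar>c\<bar> powr p - d * ((\<integral>x. f x \<partial>K t y) - c))
        + B * ((\<integral>x. \<bar>f x\<bar> powr p \<partial>K t y) + \<bar>c\<bar> powr p)"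
      using int by (simp add: prob_space)
    also have "\<dots> = deviation_bound p t e f y"
      using elim(1) by (simp only: deviation_bound_def A_def B_def c[symmetric] c_def[symmetric]) simp
    finally show ?case using I by (simp add: c_def)
  qed
qed

text \<open>The integral of \<open>P t (\<lambda>x. \<bar>f x\<bar> powr p)\<close> stays as it is,
  because \<open>integral_P_le\<close> compares it with the integral of the p-th power of
  \<open>f\<close> in one direction only.\<close>

lemma
  assumes p: "1 < p" "p \<le> 2" and t: "0 < t" and e: "0 < e" and f: "f \<in> Lp M (ennreal p)"
  shows integrable_deviation_bound: "integrable M (deviation_bound p t e f)"
    and integral_deviation_bound: "(\<integral>y. deviation_bound p t e f y \<partial>M)
      = 2 / (p - 1) * e powr (p - 2) * ((\<integral>y. P t (\<lambda>x. \<bar>f x\<bar> powr p) y \<partial>M) - Lp_norm M p (P t f) powr p)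
        + 2 * e powr p * ((\<integral>y. P t (\<lambda>x. \<bar>f x\<bar> powr p) y \<partial>M) + Lp_norm M p (P t f) powr p)"
proof -
  have p1: "1 \<le> p" and t0: "0 \<le> t" using p t by auto
  have int: "integrable M (P t (\<lambda>x. \<bar>f x\<bar> powr p))" "integrable M (\<lambda>y. \<bar>P t f y\<bar> powr p)"
    using LpD(2)[OF p1 f] LpD(2)[OF p1 P_Lp[OF p1 t0 f]] integrable_P[OF t0] by auto
  define A where "A = 2 / (p - 1) * e powr (p - 2)"
  define B where "B = 2 * e powr p"
  have eq: "deviation_bound p t e f = (\<lambda>y. A * (P t (\<lambda>x. \<bar>f x\<bar> powr p) y - \<bar>P t f y\<bar> powr p)
      + B * (P t (\<lambda>x. \<bar>f x\<bar> powr p) y + \<bar>P t f y\<bar> powr p))"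
    unfolding deviation_bound_def A_def B_def ..
  show "integrable M (deviation_bound p t e f)"
    unfolding eq using int by simp
  have "Lp_norm M p (P t f) powr p = (\<integral>y. \<bar>P t f y\<bar> powr p \<partial>M)"
    using p by (intro Lp_norm_powr) simp
  then show "(\<integral>y. deviation_bound p t e f y \<partial>M)
      = 2 / (p - 1) * e powr (p - 2) * ((\<integral>y. P t (\<lambda>x. \<bar>f x\<bar> powr p) y \<partial>M) - Lp_norm M p (P t f) powr p)
        + 2 * e powr p * ((\<integral>y. P t (\<lambda>x. \<bar>f x\<bar> powr p) y \<partial>M) + Lp_norm M p (P t f) powr p)"
    unfolding eq A_def[symmetric] B_def[symmetric] using int by simp
qed

section \<open>Decay of differences along the semigroup\<close>

text \<open>Pair \<open>v\<close>, the difference, with its dual element \<open>h\<close>. Symmetry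
  moves one \<open>P t\<close> onto \<open>h\<close>, and inserting \<open>P t\<close> of the
  product \<open>f h\<close> splits the pairing into a loss of mass and a covariance under the
  kernel. Young's inequality bounds both by the deviation of \<open>f\<close> and a part of the norm
  of \<open>v\<close> that can be absorbed.\<close>

lemma square_defect_estimate:
  assumes p: "1 < p" "p \<le> 2" and t: "0 < t" and e: "0 < e" "e \<le> 1" and f: "f \<in> Lp M (ennreal p)"
  shows "Lp_norm M p (\<lambda>x. f x - P t (P t f) x) powr p
    \<le> 8 / (p - 1) * e powr (p - 2) * (Lp_norm M p f powr p - Lp_norm M p (P t f) powr p)
      + 16 * e powr p * Lp_norm M p f powr p"
proof -
  define q where "q = p / (p - 1)"
  have p1: "1 \<le> p" and p0: "0 < p" and t0: "0 \<le> t" and q1: "1 \<le> q"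
    using p t by (auto simp: q_def)
  note pq = p(1) q_def
  define v where "v = (\<lambda>x. f x - P t (P t f) x)"
  \<comment> \<open>Chosen so that \<open>v x * h x\<close> is
    \<open>\<bar>v x\<bar> powr p\<close>.\<close>
  define h where "h = (\<lambda>x. signed_powr (p - 1) (v x))"
  have Pf: "P t f \<in> Lp M (ennreal p)" and PPf: "P t (P t f) \<in> Lp M (ennreal p)"
    using f P_Lp[OF p1 t0] by auto
  have v: "v \<in> Lp M (ennreal p)" unfolding v_def by (rule Lp_diff[OF p1 f PPf])
  have h: "h \<in> Lp M (ennreal q)" unfolding h_def by (rule Lp_signed_powr[OF pq v])
  have Ph: "P t h \<in> Lp M (ennreal q)" by (rule P_Lp[OF q1 t0 h])
  let ?fp = "\<lambda>x. \<bar>f x\<bar> powr p" and ?vp = "\<lambda>x. \<bar>v x\<bar> powr p"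
  have int: "integrable M ?fp" "integrable M ?vp" "integrable M (\<lambda>x. f x * h x)"
      "integrable M (\<lambda>x. P t (P t f) x * h x)" "integrable M (\<lambda>x. P t f x * P t h x)"
    using LpD(2)[OF p1] f v Lp_mult_integrable[OF pq] PPf h Pf Ph by auto
  have intP: "integrable M (P t ?fp)" "integrable M (P t ?vp)" "integrable M (P t (\<lambda>x. f x * h x))"
    using int integrable_P[OF t0] by auto
  have young: "\<bar>a * h x\<bar> \<le> 2 * \<bar>a\<bar> powr p + \<bar>v x\<bar> powr p / 2" for a x
    using mult_powr_minus_one_le[OF p, of "\<bar>a\<bar>" "\<bar>v x\<bar>"] p by (simp add: h_def abs_mult abs_signed_powr)

  have V: "(\<integral>x. ?vp x \<partial>M) = (\<integral>x. f x * h x \<partial>M) - (\<integral>x. P t f x * P t h x \<partial>M)"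
  proof -
    have "(\<integral>x. ?vp x \<partial>M) = (\<integral>x. f x * h x - P t (P t f) x * h x \<partial>M)"
      using signed_powr_mult_self[OF p(1)]
      by (intro Bochner_Integration.integral_cong) (simp_all add: h_def v_def flip: left_diff_distrib)
    also have "\<dots> = (\<integral>x. f x * h x \<partial>M) - (\<integral>x. P t (P t f) x * h x \<partial>M)"
      using int by simp
    also have "(\<integral>x. P t (P t f) x * h x \<partial>M) = (\<integral>x. P t f x * P t h x \<partial>M)"
      by (rule P_symmetric[OF pq t Pf h])
    finally show ?thesis .
  qed
  have L1: "?fp \<in> Lp M (ennreal 1)" "?vp \<in> Lp M (ennreal 1)" "(\<lambda>x. f x * h x) \<in> Lp M (ennreal 1)"
    using int by (auto simp: L1_iff_integrable)
  \<comment> \<open>The majorant of \<open>f x * h x\<close> from Young's inequality; monotonicity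
    of the mass defect carries it over to the integrals.\<close>
  let ?w = "\<lambda>x. 2 * ?fp x + 1 / 2 * ?vp x"
  have w: "integrable M ?w" and Pw: "integrable M (\<lambda>x. 2 * P t ?fp x + 1 / 2 * P t ?vp x)"
    using int intP by (intro Bochner_Integration.integrable_add integrable_mult_right; simp)+
  have fh_le: "f x * h x \<le> ?w x" for x
    using order_trans[OF abs_ge_self young[of "f x" x]] by simp
  have "(\<integral>x. f x * h x \<partial>M) - (\<integral>x. P t (\<lambda>x. f x * h x) x \<partial>M) \<le> (\<integral>x. ?w x \<partial>M) - (\<integral>x. P t ?w x \<partial>M)"
    by (rule integral_P_defect_mono[OF t0 int(3) w]) (rule AE_I2, rule fh_le)
  also have "(\<integral>x. P t ?w x \<partial>M) = (\<integral>x. 2 * P t ?fp x + 1 / 2 * P t ?vp x \<partial>M)"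
    by (rule integral_cong_AE[OF borel_measurable_integrable[OF integrable_P[OF t0 w]]
          borel_measurable_integrable[OF Pw] P_linear[OF order_refl t0 L1(1,2)]])
  finally have I1: "(\<integral>x. f x * h x \<partial>M) - (\<integral>x. P t (\<lambda>x. f x * h x) x \<partial>M)
      \<le> 2 * ((\<integral>x. ?fp x \<partial>M) - (\<integral>x. P t ?fp x \<partial>M)) + ((\<integral>x. ?vp x \<partial>M) - (\<integral>x. P t ?vp x \<partial>M)) / 2"
    using int intP by (simp add: right_diff_distrib diff_divide_distrib)

  have "AE y in M. P t (\<lambda>x. f x * h x) y - P t f y * P t h y
      \<le> 2 * deviation_bound p t e f y + 1 / 2 * P t ?vp y"
    using P_eq_kernel[OF p1 t0 t f] P_eq_kernel[OF q1 t0 t h] P_eq_kernel[OF order_refl t0 t L1(3)]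
      P_eq_kernel[OF order_refl t0 t L1(2)] kernel_deviation[OF p t e(1) f]
  proof eventually_elim
    case (elim y)
    define c where "c = P t f y"
    have int: "integrable (K t y) h" "integrable (K t y) (\<lambda>x. f x * h x)"
        "integrable (K t y) ?vp" "integrable (K t y) (\<lambda>x. \<bar>f x - c\<bar> powr p)"
      unfolding c_def using elim by blast+
    have "P t (\<lambda>x. f x * h x) y - P t f y * P t h y = (\<integral>x. f x * h x \<partial>K t y) - c * (\<integral>x. h x \<partial>K t y)"
      using elim(1-3) unfolding c_def by metis
    \<comment> \<open>Centring \<open>f\<close> at its kernel mean \<open>c\<close> is what brings
      in the deviation.\<close>
    also have "\<dots> = (\<integral>x. f x * h x - c * h x \<partial>K t y)"
      using int by simp
    also have "\<dots> \<le> (\<integral>x. 2 * \<bar>f x - c\<bar> powr p + 1 / 2 * ?vp x \<partial>K t y)"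
    proof (intro integral_mono)
      show "f x * h x - c * h x \<le> 2 * \<bar>f x - c\<bar> powr p + 1 / 2 * ?vp x" for x
        using young[of "f x - c" x] by (simp add: algebra_simps)
    qed (use int in auto)
    also have "\<dots> = 2 * (\<integral>x. \<bar>f x - c\<bar> powr p \<partial>K t y) + 1 / 2 * (\<integral>x. ?vp x \<partial>K t y)"
      using int(3,4) by simp
    also have "\<dots> \<le> 2 * deviation_bound p t e f y + 1 / 2 * P t ?vp y"
      using elim(4,5) unfolding c_def by linarith
    finally show ?case .
  qed
  then have "(\<integral>y. P t (\<lambda>x. f x * h x) y - P t f y * P t h y \<partial>M)
      \<le> (\<integral>y. 2 * deviation_bound p t e f y + 1 / 2 * P t ?vp y \<partial>M)"
    using int intP integrable_deviation_bound[OF p t e(1) f] by (intro integral_mono_AE) auto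
  then have I2: "(\<integral>y. P t (\<lambda>x. f x * h x) y \<partial>M) - (\<integral>y. P t f y * P t h y \<partial>M)
      \<le> 2 * (\<integral>y. deviation_bound p t e f y \<partial>M) + (\<integral>y. P t ?vp y \<partial>M) / 2"
    using int intP integrable_deviation_bound[OF p t e(1) f] by simp

  define X where "X = Lp_norm M p f powr p"
  define Y where "Y = (\<integral>y. P t ?fp y \<partial>M)"
  define Z where "Z = Lp_norm M p (P t f) powr p"
  define a where "a = 2 / (p - 1) * e powr (p - 2)"
  define b where "b = 2 * e powr p"
  have X: "(\<integral>x. ?fp x \<partial>M) = X" using p0 by (simp add: X_def Lp_norm_powr)
  have YX: "Y \<le> X" using integral_P_le[OF t0 int(1)] by (simp add: Y_def X[symmetric])
  have ZX: "Z \<le> X" unfolding Z_def X_def using P_contraction[OF p1 t0 f] p0 by (intro powr_mono2) auto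
  have b: "b \<ge> 0" by (simp add: b_def)
  \<comment> \<open>For \<open>e \<le> 1\<close> the weight \<open>a\<close> is at least \<open>1\<close>, so the lost mass \<open>X - Y\<close> is absorbed into \<open>a * (X - Z)\<close>.\<close>
  have "1 * 1 \<le> 2 / (p - 1) * e powr (p - 2)"
    using p e powr_mono2'[of "p - 2" e 1] by (intro mult_mono) (auto simp: field_simps)
  then have a: "1 \<le> a" by (simp add: a_def)
  have dev: "(\<integral>y. deviation_bound p t e f y \<partial>M) = a * (Y - Z) + b * (Y + Z)"
    unfolding a_def b_def Y_def Z_def by (rule integral_deviation_bound[OF p t e(1) f])
  have "(\<integral>x. ?vp x \<partial>M)
      \<le> 4 * ((\<integral>x. ?fp x \<partial>M) - (\<integral>x. P t ?fp x \<partial>M)) + 4 * (\<integral>y. deviation_bound p t e f y \<partial>M)"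
  \<comment> \<open>In the sum of the two estimates \<open>V'\<close> cancels, and
    \<open>V / 2\<close> is absorbed on the left, doubling the remaining constants from
    \<open>2\<close> to \<open>4\<close>.\<close>
  proof -
    have "V \<le> 4 * (X - Y) + 4 * D"
      if "V = a - b" "a - c \<le> 2 * (X - Y) + (V - V') / 2" "c - b \<le> 2 * D + V' / 2"
      for V V' X Y D a b c :: real
      using that by argo
    from this[OF V I1 I2] show ?thesis .
  qed
  also have "\<dots> = 4 * (X - Y) + 4 * (a * (Y - Z) + b * (Y + Z))"
    by (simp only: X dev Y_def[symmetric])
  also have "\<dots> \<le> 4 * (a * (X - Y)) + 4 * (a * (Y - Z) + b * (X + X))"
  proof -
    have "1 * (X - Y) \<le> a * (X - Y)" using a YX by (intro mult_right_mono) auto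
    moreover have "b * (Y + Z) \<le> b * (X + X)" using b YX ZX by (intro mult_left_mono) auto
    ultimately show ?thesis by simp
  qed
  also have "\<dots> = 4 * a * (X - Z) + 8 * b * X"
    by (simp add: algebra_simps)
  finally have "Lp_norm M p v powr p \<le> 4 * a * (X - Z) + 8 * b * X"
    by (simp only: Lp_norm_powr[OF p0])
  moreover have "4 * a = 8 / (p - 1) * e powr (p - 2)" "8 * b = 16 * e powr p"
    by (simp_all add: a_def b_def)
  ultimately show ?thesis
    unfolding X_def Z_def v_def by (simp only:)
qed

text \<open>This and the next two are the powers of \<open>I - P s\<close> applied to
  \<open>P t f\<close>. Expanding them in semigroup times gives exact identities between them, free
  of exceptional null sets.\<close>

definition increment :: "('a \<Rightarrow> real) \<Rightarrow> real \<Rightarrow> real \<Rightarrow> 'a \<Rightarrow> real" where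
  "increment f s t x = P t f x - P (t + s) f x"

definition second_difference :: "('a \<Rightarrow> real) \<Rightarrow> real \<Rightarrow> real \<Rightarrow> 'a \<Rightarrow> real" where
  "second_difference f s t x = P t f x - 2 * P (t + s) f x + P (t + 2 * s) f x"

definition third_difference :: "('a \<Rightarrow> real) \<Rightarrow> real \<Rightarrow> real \<Rightarrow> 'a \<Rightarrow> real" where
  "third_difference f s t x = P t f x - 3 * P (t + s) f x + 3 * P (t + 2 * s) f x - P (t + 3 * s) f x"

text \<open>Two balanced terms with coefficient \<open>16 / (p - 1)\<close>, followed by the p-th
  root.\<close>

definition sqrt_decay_const :: "real \<Rightarrow> real" where
  "sqrt_decay_const p = (32 / (p - 1)) powr (1 / p)"

text \<open>Three differences, each over a third of the time, which costs
  \<open>3 powr (1 / 2)\<close> per factor.\<close>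

definition third_decay_const :: "real \<Rightarrow> real" where
  "third_decay_const p = (sqrt_decay_const p * 3 powr (1 / 2)) ^ 3"

text \<open>The value of \<open>B + 6 * k\<close> in \<open>double_scale_linear_bound\<close> for
  \<open>B = 2\<close> and \<open>k = 2 + 2 * third_decay_const p\<close>.\<close>

definition linear_decay_const :: "real \<Rightarrow> real" where
  "linear_decay_const p = 14 + 12 * third_decay_const p"

definition besov_const :: "real \<Rightarrow> real" where
  "besov_const p = 8 * linear_decay_const p / (p - 1) + 8 + 2 * sqrt_decay_const p powr p"

section \<open>Increments along the semigroup and their square-root decay\<close>

context
  fixes p :: real
  assumes p: "1 < p" "p \<le> 2"
begin

lemma p_ge_1: "1 \<le> p" using p by simp

lemma P_compose:
  assumes "0 \<le> t" "0 \<le> s" "f \<in> Lp M (ennreal p)"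
  shows "AE x in M. P t (P s f) x = P (t + s) f x"
  using P_add_time[OF p_ge_1 assms] by auto

lemma increment_Lp:
  "0 \<le> s \<Longrightarrow> 0 \<le> t \<Longrightarrow> f \<in> Lp M (ennreal p) \<Longrightarrow> increment f s t \<in> Lp M (ennreal p)"
  unfolding increment_def[abs_def] by (intro Lp_diff[OF p_ge_1] P_Lp[OF p_ge_1]) auto

lemma P_increment:
  assumes "0 \<le> s" "0 \<le> t" "0 \<le> r" "f \<in> Lp M (ennreal p)"
  shows "AE x in M. P r (increment f s t) x = increment f s (r + t) x"
proof -
  have "AE x in M. P r (increment f s t) x = P r (P t f) x - P r (P (t + s) f) x"
    unfolding increment_def[abs_def] using assms P_Lp[OF p_ge_1] by (intro P_diff[OF p_ge_1]) auto
  moreover have "AE x in M. P r (P t f) x = P (r + t) f x"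
    using assms by (intro P_compose) auto
  moreover have "AE x in M. P r (P (t + s) f) x = P (r + (t + s)) f x"
    using assms by (intro P_compose) auto
  ultimately show ?thesis
    by eventually_elim (simp add: increment_def add.assoc)
qed

lemma increment_increment:
  assumes "0 \<le> s" "0 \<le> t" "0 \<le> r" "f \<in> Lp M (ennreal p)"
  shows "AE x in M. increment (increment f s t) s r x = increment f s (r + t) x - increment f s (r + t + s) x"
proof -
  have "AE x in M. P (r + s) (increment f s t) x = increment f s (r + s + t) x"
    using assms by (intro P_increment) auto
  then show ?thesis
    using P_increment[OF assms]
    by eventually_elim (simp add: increment_def add_ac)
qed

lemma increment_norm_le:
  assumes "0 \<le> s" "0 \<le> t" "f \<in> Lp M (ennreal p)"
  shows "Lp_norm M p (increment f s t) \<le> 2 * Lp_norm M p f"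
proof -
  have "Lp_norm M p (increment f s t) \<le> Lp_norm M p (P t f) + Lp_norm M p (P (t + s) f)"
    unfolding increment_def[abs_def]
    using assms by (intro Lp_norm_triangle_diff[OF p_ge_1] P_Lp[OF p_ge_1]) auto
  also have "\<dots> \<le> Lp_norm M p f + Lp_norm M p f"
    using assms by (intro add_mono P_contraction[OF p_ge_1]) auto
  finally show ?thesis by simp
qed

text \<open>The later increment is the image of the earlier one under the contraction
  \<open>P (t' - t)\<close>. So a bound at any earlier time serves at \<open>t'\<close>, which
  permits averaging over times.\<close>

lemma increment_norm_antimono:
  assumes "0 \<le> s" "0 \<le> t" "t \<le> t'" "f \<in> Lp M (ennreal p)"
  shows "Lp_norm M p (increment f s t') \<le> Lp_norm M p (increment f s t)"
proof -
  have "AE x in M. increment f s t' x = P (t' - t) (increment f s t) x"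
    using P_increment[of s t "t' - t" f] assms by auto
  then have "Lp_norm M p (increment f s t') = Lp_norm M p (P (t' - t) (increment f s t))"
    using assms by (intro Lp_norm_cong_AE LpD(1)[OF p_ge_1] P_Lp[OF p_ge_1] increment_Lp) auto
  then show ?thesis
    using P_contraction[OF p_ge_1 _ increment_Lp] assms by simp
qed

text \<open>\<open>square_defect_estimate\<close> for \<open>P t f\<close>; its operator is the
  square of \<open>P s\<close>, hence the step \<open>2 * s\<close>. The drop of the norm is now a
  difference of consecutive times and can be telescoped.\<close>

lemma increment_norm_powr_le:
  assumes t: "0 \<le> t" and s: "0 < s" and e: "0 < e" "e \<le> 1" and f: "f \<in> Lp M (ennreal p)"
  shows "Lp_norm M p (increment f (2 * s) t) powr p
    \<le> 16 / (p - 1) * e powr (p - 2) * (Lp_norm M p (P t f) powr p - Lp_norm M p (P (t + s) f) powr p)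
      + 16 / (p - 1) * e powr p * Lp_norm M p f powr p"
proof -
  define u where "u = P t f"
  have u: "u \<in> Lp M (ennreal p)" unfolding u_def by (rule P_Lp[OF p_ge_1 t f])
  have su: "P s u \<in> Lp M (ennreal p)" and ssu: "P s (P s u) \<in> Lp M (ennreal p)"
    using P_Lp[OF p_ge_1 less_imp_le[OF s]] u by auto
  have meas: "P (t + r) f \<in> borel_measurable M" if "r \<ge> 0" for r
    using t that by (intro LpD(1)[OF p_ge_1] P_Lp[OF p_ge_1] f) auto
  have su_eq: "AE x in M. P s u x = P (t + s) f x"
    using P_compose[of s t f] s t f by (simp add: u_def add.commute)
  have "AE x in M. P s (P s u) x = P s (P (t + s) f) x"
    using s t f su_eq by (intro P_cong_AE[OF p_ge_1 _ su] P_Lp[OF p_ge_1]) auto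
  moreover have "AE x in M. P s (P (t + s) f) x = P (t + 2 * s) f x"
  proof -
    have eq: "t + 2 * s = s + (t + s)" by simp
    show ?thesis unfolding eq by (rule P_compose) (use s t f in auto)
  qed
  ultimately have "AE x in M. increment f (2 * s) t x = u x - P s (P s u) x"
    by eventually_elim (simp add: increment_def u_def)
  then have 1: "Lp_norm M p (increment f (2 * s) t) = Lp_norm M p (\<lambda>x. u x - P s (P s u) x)"
    using s t by (intro Lp_norm_cong_AE LpD(1)[OF p_ge_1] increment_Lp Lp_diff[OF p_ge_1 u ssu] f) auto
  have 2: "Lp_norm M p (P s u) = Lp_norm M p (P (t + s) f)"
    using s by (intro Lp_norm_cong_AE su_eq LpD(1)[OF p_ge_1 su] meas) auto
  have le: "Lp_norm M p (P s u) \<le> Lp_norm M p u"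
    using s by (intro P_contraction[OF p_ge_1 _ u]) auto
  \<comment> \<open>Both coefficients are raised to \<open>16 / (p - 1)\<close>, using
    \<open>p - 1 \<le> 1\<close>.\<close>
  have c: "8 / (p - 1) \<le> 16 / (p - 1)" "16 \<le> 16 / (p - 1)" using p by (auto simp: field_simps)
  have "Lp_norm M p (increment f (2 * s) t) powr p
      \<le> 8 / (p - 1) * e powr (p - 2) * (Lp_norm M p u powr p - Lp_norm M p (P s u) powr p)
        + 16 * e powr p * Lp_norm M p u powr p"
    unfolding 1 by (rule square_defect_estimate[OF p s e u])
  also have "\<dots> \<le> 16 / (p - 1) * e powr (p - 2) * (Lp_norm M p u powr p - Lp_norm M p (P s u) powr p)
        + 16 / (p - 1) * e powr p * Lp_norm M p f powr p"
    using c le P_contraction[OF p_ge_1 t f] p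
    by (intro add_mono mult_right_mono mult_mono powr_mono2) (auto simp: u_def intro!: powr_mono2)
  finally show ?thesis unfolding 2 unfolding u_def .
qed

lemma sqrt_decay_const_ge: "2 \<le> sqrt_decay_const p"
proof -
  have "(2 powr p) powr (1 / p) \<le> sqrt_decay_const p"
    unfolding sqrt_decay_const_def
  proof (rule powr_mono2)
    have "2 powr p \<le> 2 powr (2 :: real)" using p by (intro powr_mono) auto
    also have "\<dots> \<le> 32 / (p - 1)" using p by (simp add: field_simps)
    finally show "2 powr p \<le> 32 / (p - 1)" .
  qed (use p in auto)
  then show ?thesis using p by (simp add: powr_powr)
qed

text \<open>For \<open>t \<le> s\<close> the trivial factor \<open>2\<close> suffices. Otherwise the
  estimate with step \<open>s / 2\<close> is summed over \<open>n\<close> times before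
  \<open>t\<close>: the left side is at least \<open>n\<close> copies of the quantity at
  \<open>t\<close>, while the drops on the right telescope to at most the p-th power of the norm of
  \<open>f\<close>.\<close>

lemma increment_sqrt_decay:
  assumes s: "0 < s" and t: "0 < t" and f: "f \<in> Lp M (ennreal p)"
  shows "Lp_norm M p (increment f s t) \<le> sqrt_decay_const p * (s / t) powr (1 / 2) * Lp_norm M p f"
proof (cases "t \<le> s")
  case True
  then have "1 \<le> (s / t) powr (1 / 2)" using t by (intro ge_one_powr_ge_zero) auto
  then have "2 * 1 \<le> sqrt_decay_const p * (s / t) powr (1 / 2)"
    using sqrt_decay_const_ge by (intro mult_mono) auto
  then have "2 * Lp_norm M p f \<le> sqrt_decay_const p * (s / t) powr (1 / 2) * Lp_norm M p f"
    by (intro mult_right_mono) auto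
  then show ?thesis using increment_norm_le[of s t f] s t f by linarith
next
  case False
  \<comment> \<open>The number of half steps that fit into \<open>t\<close>. As
    \<open>t > s\<close>, rounding down still leaves \<open>n \<ge> t / s\<close>.\<close>
  define n where "n = nat \<lfloor>2 * t / s\<rfloor>"
  have ts: "1 < t / s" using False s by simp
  have "0 \<le> 2 * t / s" using s t by simp
  then have n: "real n \<le> 2 * t / s" "2 * t / s - 1 < real n"
    by (simp_all add: n_def)
  then have n_ge: "t / s \<le> real n" using ts by simp
  then have n1: "1 \<le> real n" using ts by simp
  have ns: "real k * (s / 2) \<le> t" if "k < n" for k
  proof -
    have "real k * (s / 2) \<le> (2 * t / s) * (s / 2)"
      using n(1) that s by (intro mult_right_mono) auto
    then show ?thesis using s by simp
  qed
  \<comment> \<open>This choice balances the two terms of the sum over \<open>k\<close> in \<open>step\<close>.\<close>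
  define e where "e = real n powr (- 1 / 2)"
  have e: "0 < e" "e \<le> 1" using n1 powr_mono2'[of "- 1 / 2" 1 "real n"] by (auto simp: e_def)
  define A where "A = Lp_norm M p f"
  define X where "X = Lp_norm M p (increment f s t)"
  define a where "a k = Lp_norm M p (P (real k * (s / 2)) f) powr p" for k
  define c where "c = 16 / (p - 1)"
  have c: "0 \<le> c" using p by (simp add: c_def)
  have step: "X powr p \<le> c * e powr (p - 2) * (a k - a (Suc k)) + c * e powr p * A powr p" if "k < n" for k
  proof -
    have "X \<le> Lp_norm M p (increment f s (real k * (s / 2)))"
      unfolding X_def using s ns[OF that] f by (intro increment_norm_antimono) auto
    then have "X powr p \<le> Lp_norm M p (increment f (2 * (s / 2)) (real k * (s / 2))) powr p"
      using p by (intro powr_mono2) (auto simp: X_def)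
    also have "\<dots> \<le> c * e powr (p - 2)
        * (Lp_norm M p (P (real k * (s / 2)) f) powr p - Lp_norm M p (P (real k * (s / 2) + s / 2) f) powr p)
        + c * e powr p * A powr p"
      unfolding c_def A_def by (rule increment_norm_powr_le) (use s e f in auto)
    also have "real k * (s / 2) + s / 2 = real (Suc k) * (s / 2)"
      by (simp add: algebra_simps)
    finally show ?thesis unfolding a_def .
  qed
  have "real n * X powr p = (\<Sum>k<n. X powr p)" by simp
  also have "\<dots> \<le> (\<Sum>k<n. c * e powr (p - 2) * (a k - a (Suc k)) + c * e powr p * A powr p)"
    by (intro sum_mono step) auto
  also have "\<dots> = c * e powr (p - 2) * (\<Sum>k<n. a k - a (Suc k)) + real n * (c * e powr p * A powr p)"
    by (simp add: sum.distrib flip: sum_distrib_left)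
  also have "(\<Sum>k<n. a k - a (Suc k)) = a 0 - a n"
    by (rule sum_lessThan_telescope')
  also have "c * e powr (p - 2) * (a 0 - a n) \<le> c * e powr (p - 2) * A powr p"
  proof (intro mult_left_mono)
    have "a 0 \<le> A powr p"
      unfolding a_def A_def using p P_contraction[OF p_ge_1 _ f] by (intro powr_mono2) auto
    moreover have "0 \<le> a n" by (simp add: a_def)
    ultimately show "a 0 - a n \<le> A powr p" by linarith
  qed (use c in auto)
  also have "e powr (p - 2) = real n powr (1 - p / 2)"
    using n1 by (simp add: e_def powr_powr algebra_simps diff_divide_distrib)
  also have "real n * (c * e powr p * A powr p) = c * real n powr (1 - p / 2) * A powr p"
  proof -
    have "real n * e powr p = real n powr 1 * real n powr (- (p / 2))"
      using n1 by (simp add: e_def powr_powr)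
    also have "\<dots> = real n powr (1 - p / 2)" by (simp only: powr_add[symmetric]) simp
    finally show ?thesis by (simp add: mult_ac)
  qed
  finally have "real n * X powr p \<le> 2 * c * real n powr (1 - p / 2) * A powr p"
    by (simp add: mult_ac)
  also have "real n powr (1 - p / 2) = real n * (real n powr (- 1 / 2)) powr p"
    using n1 powr_add[of "real n" 1 "- (p / 2)"] by (simp add: powr_powr)
  finally have "real n * X powr p \<le> real n * ((32 / (p - 1)) * (real n powr (- 1 / 2)) powr p * A powr p)"
    by (simp add: c_def mult_ac)
  then have "X powr p \<le> (32 / (p - 1)) * (real n powr (- 1 / 2)) powr p * A powr p"
    using n1 by (simp only: mult_le_cancel_left_pos)
  also have "32 / (p - 1) = sqrt_decay_const p powr p"
    using p by (simp add: sqrt_decay_const_def powr_powr)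
  also have "sqrt_decay_const p powr p * (real n powr (- 1 / 2)) powr p * A powr p
      = (sqrt_decay_const p * real n powr (- 1 / 2) * A) powr p"
    by (simp only: powr_mult)
  finally have le: "X powr p \<le> (sqrt_decay_const p * real n powr (- 1 / 2) * A) powr p" .
  have "X \<le> sqrt_decay_const p * real n powr (- 1 / 2) * A"
  proof (rule ccontr)
    assume "\<not> X \<le> sqrt_decay_const p * real n powr (- 1 / 2) * A"
    then have "(sqrt_decay_const p * real n powr (- 1 / 2) * A) powr p < X powr p"
      using p sqrt_decay_const_ge by (intro powr_less_mono2) (auto simp: A_def)
    then show False using le by simp
  qed
  also have "\<dots> \<le> sqrt_decay_const p * (t / s) powr (- 1 / 2) * A"
    using n_ge ts sqrt_decay_const_ge
    by (intro mult_right_mono mult_left_mono powr_mono2') (auto simp: A_def)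
  also have "(t / s) powr (- 1 / 2) = (s / t) powr (1 / 2)"
    using s t by (simp add: powr_minus powr_divide)
  finally show ?thesis unfolding X_def A_def .
qed

section \<open>Higher differences and linear decay\<close>

lemma
  assumes "0 \<le> s" "0 \<le> t" "f \<in> Lp M (ennreal p)"
  shows second_difference_Lp: "second_difference f s t \<in> Lp M (ennreal p)"
    and third_difference_Lp: "third_difference f s t \<in> Lp M (ennreal p)"
  unfolding second_difference_def[abs_def] third_difference_def[abs_def] using assms p_ge_1
  by (auto intro!: Lp_add Lp_diff Lp_mult P_Lp)

lemma third_decay_const_nonneg: "0 \<le> third_decay_const p"
  using sqrt_decay_const_ge by (simp add: third_decay_const_def)

text \<open>Cut \<open>t\<close> into three equal pieces and use one piece for each factor
  \<open>I - P s\<close>; the three square-root gains multiply.\<close>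

lemma third_difference_decay:
  assumes s: "0 < s" and t: "0 < t" and f: "f \<in> Lp M (ennreal p)"
  shows "Lp_norm M p (third_difference f s t) \<le> third_decay_const p * (s / t) powr (3 / 2) * Lp_norm M p f"
proof -
  define r where "r = t / 3"
  have r: "0 < r" using t by (simp add: r_def)
  have s0: "0 \<le> s" and r0: "0 \<le> r" using s r by auto
  define w1 where "w1 = increment f s r"
  define w2 where "w2 = increment w1 s r"
  define w3 where "w3 = increment w2 s r"
  have w1: "w1 \<in> Lp M (ennreal p)" unfolding w1_def by (rule increment_Lp[OF s0 r0 f])
  have w2: "w2 \<in> Lp M (ennreal p)" unfolding w2_def by (rule increment_Lp[OF s0 r0 w1])
  have w3: "w3 \<in> Lp M (ennreal p)" unfolding w3_def by (rule increment_Lp[OF s0 r0 w2])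
  have eqs: "r + r + r = t" "r + r + s + r = t + s" by (auto simp: r_def)
  have "t + s + s = t + 2 * s" "t + s + s + s = t + 3 * s" by auto
  then have third: "increment f s t x - increment f s (t + s) x
      - (increment f s (t + s) x - increment f s (t + s + s) x) = third_difference f s t x" for x
    by (simp only: increment_def third_difference_def)
  have "AE x in M. w3 x = increment w1 s (r + r) x - increment w1 s (r + r + s) x"
    unfolding w3_def w2_def by (rule increment_increment[OF s0 r0 r0 w1])
  moreover have "AE x in M. increment w1 s (r + r) x
      = increment f s (r + r + r) x - increment f s (r + r + r + s) x"
    unfolding w1_def using s r f by (intro increment_increment) auto
  moreover have "AE x in M. increment w1 s (r + r + s) x
      = increment f s (r + r + s + r) x - increment f s (r + r + s + r + s) x"
    unfolding w1_def using s r f by (intro increment_increment) auto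
  ultimately have "AE x in M. third_difference f s t x = w3 x"
    unfolding eqs by eventually_elim (simp only: third)
  then have "Lp_norm M p (third_difference f s t) = Lp_norm M p w3"
    using s t f by (intro Lp_norm_cong_AE LpD(1)[OF p_ge_1] third_difference_Lp w3) auto
  also define b where "b = sqrt_decay_const p * (s / r) powr (1 / 2)"
  have b: "0 \<le> b" using sqrt_decay_const_ge by (simp add: b_def)
  have decay: "Lp_norm M p (increment g s r) \<le> b * Lp_norm M p g" if "g \<in> Lp M (ennreal p)" for g
    unfolding b_def by (rule increment_sqrt_decay[OF s r that])
  have "Lp_norm M p w3 \<le> b * Lp_norm M p w2" unfolding w3_def by (rule decay[OF w2])
  also have "\<dots> \<le> b * (b * Lp_norm M p w1)"
    using b decay[OF w1] by (intro mult_left_mono) (auto simp: w2_def)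
  also have "\<dots> \<le> b * (b * (b * Lp_norm M p f))"
    using b decay[OF f] by (intro mult_left_mono) (auto simp: w1_def)
  also have "\<dots> = b ^ 3 * Lp_norm M p f"
    by (simp add: power3_eq_cube)
  also have "b = (sqrt_decay_const p * 3 powr (1 / 2)) * (s / t) powr (1 / 2)"
    using s t powr_mult[of 3 "s / t" "1 / 2"] by (simp add: b_def r_def mult_ac)
  also have "\<dots> ^ 3 = third_decay_const p * ((s / t) powr (1 / 2)) ^ 3"
    by (simp only: power_mult_distrib third_decay_const_def)
  also have "((s / t) powr (1 / 2)) ^ 3 = (s / t) powr (3 / 2)"
    using s t by (simp add: powr_power)
  finally show ?thesis .
qed

section \<open>The Besov seminorm\<close>

text \<open>At fixed \<open>t\<close>, with z for \<open>P s\<close>, the identity 4 (1 - z)^2 = (1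
  - z^2)^2 + (3 + z) (1 - z)^3 compares the scales \<open>s\<close> and \<open>2 * s\<close> up to
  third differences. This is the hypothesis of \<open>double_scale_bound\<close>.\<close>

lemma second_difference_decay:
  assumes s: "0 < s" and t: "0 < t" and f: "f \<in> Lp M (ennreal p)"
  shows "Lp_norm M p (second_difference f s t)
    \<le> (4 + 4 * third_decay_const p) * Lp_norm M p f * (s / t) powr (3 / 2)"
proof -
  note p1 = p_ge_1
  define A where "A = Lp_norm M p f"
  define k where "k = third_decay_const p"
  have k: "0 \<le> k" and A: "0 \<le> A" using third_decay_const_nonneg by (auto simp: k_def A_def)
  define c where "c x = Lp_norm M p (second_difference f (x * t) t)" for x
  have "c x \<le> c (2 * x) / 4 + k * A * x powr (3 / 2)" if x: "x > 0" for x
  proof -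
    define s where "s = x * t"
    have s: "0 < s" "s / t = x" using x t by (auto simp: s_def)
    define d0 where "d0 = third_difference f s t"
    define d1 where "d1 = third_difference f s (t + s)"
    have Lp: "second_difference f (2 * s) t \<in> Lp M (ennreal p)" "d0 \<in> Lp M (ennreal p)" "d1 \<in> Lp M (ennreal p)"
      unfolding d0_def d1_def using s t f
      by (auto intro!: second_difference_Lp third_difference_Lp)
    have d0: "Lp_norm M p d0 \<le> k * x powr (3 / 2) * A"
      using third_difference_decay[OF s(1) t f] s by (simp add: d0_def k_def A_def)
    have "Lp_norm M p d1 \<le> k * (s / (t + s)) powr (3 / 2) * A"
      using third_difference_decay[OF s(1) _ f, of "t + s"] s t by (simp add: d1_def k_def A_def)
    also have "\<dots> \<le> k * (s / t) powr (3 / 2) * A"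
      using k A s t by (intro mult_right_mono mult_left_mono powr_mono2) (auto intro!: divide_left_mono)
    finally have d1: "Lp_norm M p d1 \<le> k * x powr (3 / 2) * A" using s by simp
    have times: "t + 2 * (2 * s) = t + 4 * s" "t + s + s = t + 2 * s" "t + s + 2 * s = t + 3 * s"
        "t + s + 3 * s = t + 4 * s" by auto
    \<comment> \<open>Here \<open>d1\<close> is the third difference shifted by \<open>s\<close>,
      the z-term of the factor 3 + z.\<close>
    have eq: "(\<lambda>x. 4 * second_difference f s t x)
        = (\<lambda>x. second_difference f (2 * s) t x + (3 * d0 x + d1 x))"
      by (rule ext) (simp only: d0_def d1_def second_difference_def third_difference_def times, simp)
    have "4 * c x = Lp_norm M p (\<lambda>x. 4 * second_difference f s t x)"
      using p by (subst Lp_norm_mult) (auto simp: c_def s_def)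
    also have "\<dots> \<le> Lp_norm M p (second_difference f (2 * s) t) + Lp_norm M p (\<lambda>x. 3 * d0 x + d1 x)"
      unfolding eq using Lp by (intro Lp_norm_triangle[OF p1] Lp_add[OF p1] Lp_mult[OF p1])
    also have "Lp_norm M p (\<lambda>x. 3 * d0 x + d1 x) \<le> Lp_norm M p (\<lambda>x. 3 * d0 x) + Lp_norm M p d1"
      using Lp by (intro Lp_norm_triangle[OF p1] Lp_mult[OF p1])
    also have "Lp_norm M p (\<lambda>x. 3 * d0 x) = 3 * Lp_norm M p d0"
      using p by (subst Lp_norm_mult) auto
    also have "Lp_norm M p (second_difference f (2 * s) t) = c (2 * x)"
      by (simp add: c_def s_def mult_ac)
    finally show ?thesis using d0 d1 by (simp add: mult_ac)
  qed
  moreover have "c x \<le> 4 * A" if "x > 0" for x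
  proof -
    have xt: "0 \<le> x * t" and t0: "0 \<le> t" using that t by auto
    have 2: "t + x * t + x * t = t + 2 * (x * t)" by simp
    have "second_difference f (x * t) t = (\<lambda>y. increment f (x * t) t y - increment f (x * t) (t + x * t) y)"
      by (rule ext) (simp only: second_difference_def increment_def 2)
    then have "c x \<le> Lp_norm M p (increment f (x * t) t) + Lp_norm M p (increment f (x * t) (t + x * t))"
      unfolding c_def using xt t0 f by (auto intro!: Lp_norm_triangle_diff[OF p1] increment_Lp)
    also have "\<dots> \<le> 2 * A + 2 * A"
      unfolding A_def using xt t0 f by (intro add_mono increment_norm_le) auto
    finally show ?thesis by simp
  qed
  ultimately have "c (s / t) \<le> (4 * A + 4 * (k * A)) * (s / t) powr (3 / 2)"
    using k A s t by (intro double_scale_bound) auto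
  then show ?thesis
    using t by (simp add: c_def A_def k_def algebra_simps)
qed

text \<open>The same comparison one order lower: 2 (1 - z) = (1 - z^2) + (1 - z)^2, where the last
  term is already of order \<open>3 / 2\<close>.\<close>

lemma increment_linear_decay:
  assumes s: "0 < s" and t: "0 < t" and f: "f \<in> Lp M (ennreal p)"
  shows "Lp_norm M p (increment f s t) \<le> linear_decay_const p * Lp_norm M p f * (s / t)"
proof -
  note p1 = p_ge_1
  define A where "A = Lp_norm M p f"
  define k where "k = (2 + 2 * third_decay_const p) * A"
  have A: "0 \<le> A" by (simp add: A_def)
  then have k: "0 \<le> k" using third_decay_const_nonneg by (simp add: k_def)
  define a where "a x = Lp_norm M p (increment f (x * t) t)" for x
  have "a x \<le> a (2 * x) / 2 + k * x powr (3 / 2)" if x: "x > 0" for x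
  proof -
    define s where "s = x * t"
    have s: "0 < s" "s / t = x" using x t by (auto simp: s_def)
    have Lp: "increment f (2 * s) t \<in> Lp M (ennreal p)" "second_difference f s t \<in> Lp M (ennreal p)"
      using s t f by (auto intro!: increment_Lp second_difference_Lp)
    have eq: "(\<lambda>x. 2 * increment f s t x) = (\<lambda>x. increment f (2 * s) t x + second_difference f s t x)"
      by (rule ext) (simp add: increment_def second_difference_def)
    have "2 * a x = Lp_norm M p (\<lambda>x. 2 * increment f s t x)"
      using p by (subst Lp_norm_mult) (auto simp: a_def s_def)
    also have "\<dots> \<le> Lp_norm M p (increment f (2 * s) t) + Lp_norm M p (second_difference f s t)"
      unfolding eq by (rule Lp_norm_triangle[OF p1 Lp])
    also have "Lp_norm M p (increment f (2 * s) t) = a (2 * x)"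
      by (simp add: a_def s_def mult_ac)
    also have "Lp_norm M p (second_difference f s t) \<le> 2 * k * x powr (3 / 2)"
      using second_difference_decay[OF s(1) t f] s by (simp add: k_def A_def algebra_simps)
    finally show ?thesis by simp
  qed
  moreover have "a x \<le> 2 * A" if "x > 0" for x
    unfolding a_def A_def using that t f by (intro increment_norm_le) auto
  ultimately have "a (s / t) \<le> (2 * A + 6 * k) * (s / t)"
    using k A s t by (intro double_scale_linear_bound) auto
  then show ?thesis
    using t by (simp add: a_def A_def k_def linear_decay_const_def algebra_simps)
qed

section \<open>From decay in time to integrals against the kernel\<close>

lemma integral_deviation_bound_le:
  assumes s: "0 < s" and e: "0 < e" and g: "g \<in> Lp M (ennreal p)"
  shows "(\<integral>y. deviation_bound p s e g y \<partial>M)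
    \<le> 2 / (p - 1) * e powr (p - 2) * (Lp_norm M p g powr p - Lp_norm M p (P s g) powr p)
      + 4 * e powr p * Lp_norm M p g powr p"
proof -
  define Y where "Y = (\<integral>y. P s (\<lambda>x. \<bar>g x\<bar> powr p) y \<partial>M)"
  have p0: "0 < p" and s0: "0 \<le> s" using p s by auto
  have "Y \<le> (\<integral>x. \<bar>g x\<bar> powr p \<partial>M)"
    unfolding Y_def by (rule integral_P_le[OF s0 LpD(2)[OF p_ge_1 g]]) simp
  then have Y: "Y \<le> Lp_norm M p g powr p" using p0 by (simp add: Lp_norm_powr)
  have Z: "Lp_norm M p (P s g) powr p \<le> Lp_norm M p g powr p"
    using P_contraction[OF p_ge_1 s0 g] p0 by (intro powr_mono2) auto
  have "(\<integral>y. deviation_bound p s e g y \<partial>M)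
      = 2 / (p - 1) * e powr (p - 2) * (Y - Lp_norm M p (P s g) powr p)
        + 2 * e powr p * (Y + Lp_norm M p (P s g) powr p)"
    unfolding Y_def by (rule integral_deviation_bound[OF p s e g])
  also have "\<dots> \<le> 2 / (p - 1) * e powr (p - 2) * (Lp_norm M p g powr p - Lp_norm M p (P s g) powr p)
        + 2 * e powr p * (Lp_norm M p g powr p + Lp_norm M p g powr p)"
    using Y Z p by (intro add_mono mult_left_mono diff_right_mono) auto
  finally show ?thesis by simp
qed

text \<open>Insert the kernel mean \<open>P s g y\<close> between \<open>g x\<close> and
  \<open>g y\<close>: one part is the deviation under \<open>K s y\<close>, the other does not
  depend on \<open>x\<close> and integrates to a norm.\<close>

lemma nn_integral_increment_le:
  assumes s: "0 < s" and e: "0 < e" and g: "g \<in> Lp M (ennreal p)"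
  shows "(\<integral>\<^sup>+y. (\<integral>\<^sup>+x. ennreal (\<bar>g x - g y\<bar> powr p) \<partial>K s y) \<partial>M)
    \<le> ennreal (2 * (\<integral>y. deviation_bound p s e g y \<partial>M) + 2 * Lp_norm M p (\<lambda>y. g y - P s g y) powr p)"
proof -
  note p1 = p_ge_1
  have s0: "0 \<le> s" using s by simp
  have diff: "(\<lambda>y. g y - P s g y) \<in> Lp M (ennreal p)"
    by (rule Lp_diff[OF p1 g P_Lp[OF p1 s0 g]])
  define R where "R y = 2 * deviation_bound p s e g y + 2 * \<bar>g y - P s g y\<bar> powr p" for y
  have int: "integrable M (deviation_bound p s e g)" "integrable M (\<lambda>y. \<bar>g y - P s g y\<bar> powr p)"
    using integrable_deviation_bound[OF p s e g] LpD(2)[OF p1 diff] by auto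
  have R: "integrable M R" unfolding R_def[abs_def] using int by simp
  have "AE y in M. 0 \<le> R y \<and> (\<integral>\<^sup>+x. ennreal (\<bar>g x - g y\<bar> powr p) \<partial>K s y) \<le> ennreal (R y)"
    using kernel_deviation[OF p s e g] prob_space_kernel[OF s]
  proof eventually_elim
    case (elim y)
    interpret prob_space "K s y" by fact
    define c where "c = P s g y"
    have int: "integrable (K s y) (\<lambda>x. \<bar>g x - c\<bar> powr p)"
      and le: "(\<integral>x. \<bar>g x - c\<bar> powr p \<partial>K s y) \<le> deviation_bound p s e g y"
      using elim(1) unfolding c_def by blast+
    have "0 \<le> deviation_bound p s e g y"
      by (rule order_trans[OF integral_nonneg_AE le]) simp
    then have "0 \<le> R y" by (simp add: R_def)
    have "\<bar>g x - g y\<bar> powr p \<le> 2 * \<bar>g x - c\<bar> powr p + 2 * \<bar>g y - c\<bar> powr p" for x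
    proof -
      have "\<bar>g x - g y\<bar> powr p \<le> (\<bar>g x - c\<bar> + \<bar>g y - c\<bar>) powr p"
        using p by (intro powr_mono2) auto
      then show ?thesis using powr_add_le[OF p1 p(2), of "\<bar>g x - c\<bar>" "\<bar>g y - c\<bar>"] by simp
    qed
    then have "(\<integral>\<^sup>+x. ennreal (\<bar>g x - g y\<bar> powr p) \<partial>K s y)
        \<le> (\<integral>\<^sup>+x. ennreal (2 * \<bar>g x - c\<bar> powr p + 2 * \<bar>g y - c\<bar> powr p) \<partial>K s y)"
      by (intro nn_integral_mono ennreal_leI)
    also have "\<dots> = ennreal (\<integral>x. 2 * \<bar>g x - c\<bar> powr p + 2 * \<bar>g y - c\<bar> powr p \<partial>K s y)"
      using int by (intro nn_integral_eq_integral) auto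
    also have "(\<integral>x. 2 * \<bar>g x - c\<bar> powr p + 2 * \<bar>g y - c\<bar> powr p \<partial>K s y)
        = 2 * (\<integral>x. \<bar>g x - c\<bar> powr p \<partial>K s y) + 2 * \<bar>g y - c\<bar> powr p"
      using int by (simp add: prob_space)
    also have "ennreal \<dots> \<le> ennreal (R y)"
      unfolding R_def using le by (intro ennreal_leI) (simp add: c_def)
    finally show ?case using \<open>0 \<le> R y\<close> by blast
  qed
  then have R0: "AE y in M. 0 \<le> R y"
    and le: "AE y in M. (\<integral>\<^sup>+x. ennreal (\<bar>g x - g y\<bar> powr p) \<partial>K s y) \<le> ennreal (R y)"
    by (auto elim: eventually_mono)
  have "(\<integral>\<^sup>+y. (\<integral>\<^sup>+x. ennreal (\<bar>g x - g y\<bar> powr p) \<partial>K s y) \<partial>M) \<le> (\<integral>\<^sup>+y. ennreal (R y) \<partial>M)"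
    by (rule nn_integral_mono_AE[OF le])
  also have "\<dots> = ennreal (\<integral>y. R y \<partial>M)"
    by (rule nn_integral_eq_integral[OF R R0])
  also have "(\<integral>y. R y \<partial>M) = 2 * (\<integral>y. deviation_bound p s e g y \<partial>M) + 2 * Lp_norm M p (\<lambda>y. g y - P s g y) powr p"
  proof -
    have "Lp_norm M p (\<lambda>y. g y - P s g y) powr p = (\<integral>y. \<bar>g y - P s g y\<bar> powr p \<partial>M)"
      using p by (intro Lp_norm_powr) simp
    then show ?thesis unfolding R_def using int by simp
  qed
  finally show ?thesis .
qed

lemma linear_decay_const_pos: "0 < linear_decay_const p"
  using third_decay_const_nonneg by (simp add: linear_decay_const_def)

lemma besov_const_pos: "0 < besov_const p"
  using linear_decay_const_pos p unfolding besov_const_def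
  by (intro add_nonneg_pos add_pos_nonneg) auto

text \<open>The choice \<open>e = (s / t) powr (1 / 2)\<close> makes all terms of order
  \<open>e powr p\<close>. The drop of the norm carries the weight \<open>e powr (p - 2)\<close>, so
  it must be of order \<open>e * e\<close>; this is where linear decay, and not only square-root
  decay, is required.\<close>

lemma nn_integral_increment_semigroup_le:
  assumes s: "0 < s" and t: "0 < t" and f: "f \<in> Lp M (ennreal p)"
  shows "(\<integral>\<^sup>+y. (\<integral>\<^sup>+x. ennreal (\<bar>P t f x - P t f y\<bar> powr p) \<partial>K s y) \<partial>M)
    \<le> ennreal (besov_const p * ((s / t) powr (1 / 2) * Lp_norm M p f) powr p)"
proof -
  note p1 = p_ge_1
  have s0: "0 \<le> s" and t0: "0 \<le> t" using s t by auto
  define g where "g = P t f"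
  define A where "A = Lp_norm M p f"
  define L where "L = linear_decay_const p"
  define e where "e = (s / t) powr (1 / 2)"
  have e: "0 < e" using s t by (simp add: e_def)
  have A: "0 \<le> A" by (simp add: A_def)
  have L: "0 < L" using linear_decay_const_pos by (simp add: L_def)
  have g: "g \<in> Lp M (ennreal p)" unfolding g_def by (rule P_Lp[OF p1 t0 f])
  have sg: "P s g \<in> Lp M (ennreal p)" by (rule P_Lp[OF p1 s0 g])
  have gA: "Lp_norm M p g \<le> A" unfolding g_def A_def by (rule P_contraction[OF p1 t0 f])
  have "AE x in M. P s g x = P (t + s) f x"
    unfolding g_def using P_compose[OF s0 t0 f] by (simp add: add.commute)
  then have "AE x in M. g x - P s g x = increment f s t x"
    by eventually_elim (simp add: g_def increment_def)
  then have incr: "Lp_norm M p (\<lambda>x. g x - P s g x) = Lp_norm M p (increment f s t)"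
    by (intro Lp_norm_cong_AE LpD(1)[OF p1] Lp_diff[OF p1 g sg] increment_Lp[OF s0 t0 f])
  have ee: "s / t = e * e" using s t by (simp add: e_def flip: powr_add)
  \<comment> \<open>The reverse triangle inequality and \<open>powr_diff_le\<close> reduce the drop
    of p-th powers to the norm of an increment.\<close>
  have dec: "Lp_norm M p g powr p - Lp_norm M p (P s g) powr p \<le> 2 * L * (e * e) * A powr p"
  proof -
    have "Lp_norm M p (\<lambda>x. (g x - P s g x) + P s g x) \<le> Lp_norm M p (\<lambda>x. g x - P s g x) + Lp_norm M p (P s g)"
      by (rule Lp_norm_triangle[OF p1 Lp_diff[OF p1 g sg] sg])
    then have d: "Lp_norm M p g - Lp_norm M p (P s g) \<le> L * A * (e * e)"
      using increment_linear_decay[OF s t f] by (simp add: incr L_def A_def ee)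
    have "Lp_norm M p g powr p - Lp_norm M p (P s g) powr p
        \<le> p * Lp_norm M p g powr (p - 1) * (Lp_norm M p g - Lp_norm M p (P s g))"
      by (rule powr_diff_le[OF p1 Lp_norm_nonneg P_contraction[OF p1 s0 g]])
    also have "\<dots> \<le> 2 * A powr (p - 1) * (L * A * (e * e))"
      using d p gA P_contraction[OF p1 s0 g] A by (intro mult_mono powr_mono2) auto
    also have "\<dots> = 2 * L * (e * e) * (A powr (p - 1) * A)" by (simp add: mult_ac)
    also have "A powr (p - 1) * A = A powr p" by (rule powr_minus_one_mult[OF A])
    finally show ?thesis .
  qed
  have ep: "e powr (p - 2) * (e * e) = e powr p"
    using e powr_add[of e "p - 2" 2] by (simp add: power2_eq_square)
  have "(\<integral>y. deviation_bound p s e g y \<partial>M)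
      \<le> 2 / (p - 1) * e powr (p - 2) * (Lp_norm M p g powr p - Lp_norm M p (P s g) powr p)
        + 4 * e powr p * Lp_norm M p g powr p"
    by (rule integral_deviation_bound_le[OF s e g])
  also have "\<dots> \<le> 2 / (p - 1) * e powr (p - 2) * (2 * L * (e * e) * A powr p) + 4 * e powr p * A powr p"
    using dec gA p by (intro add_mono mult_left_mono powr_mono2) auto
  also have "\<dots> = (4 * L / (p - 1)) * (e powr (p - 2) * (e * e)) * A powr p + 4 * e powr p * A powr p"
    by simp
  also have "\<dots> = (4 * L / (p - 1) + 4) * (e * A) powr p"
    unfolding ep by (simp add: powr_mult algebra_simps)
  finally have dev: "(\<integral>y. deviation_bound p s e g y \<partial>M) \<le> (4 * L / (p - 1) + 4) * (e * A) powr p" .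
  \<comment> \<open>This term has no negative power of \<open>e\<close> in front, so square-root
    decay is enough.\<close>
  have "Lp_norm M p (\<lambda>x. g x - P s g x) \<le> sqrt_decay_const p * (e * A)"
    unfolding incr using increment_sqrt_decay[OF s t f] by (simp add: e_def A_def mult_ac)
  then have "Lp_norm M p (\<lambda>x. g x - P s g x) powr p \<le> (sqrt_decay_const p * (e * A)) powr p"
    using p by (intro powr_mono2) auto
  also have "\<dots> = sqrt_decay_const p powr p * (e * A) powr p" by (rule powr_mult)
  finally have "2 * (\<integral>y. deviation_bound p s e g y \<partial>M) + 2 * Lp_norm M p (\<lambda>y. g y - P s g y) powr p
      \<le> 2 * ((4 * L / (p - 1) + 4) * (e * A) powr p) + 2 * (sqrt_decay_const p powr p * (e * A) powr p)"
    using dev by (intro add_mono mult_left_mono) auto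
  also have "\<dots> = besov_const p * (e * A) powr p"
    by (simp add: besov_const_def L_def algebra_simps)
  finally have "ennreal (2 * (\<integral>y. deviation_bound p s e g y \<partial>M) + 2 * Lp_norm M p (\<lambda>y. g y - P s g y) powr p)
      \<le> ennreal (besov_const p * (e * A) powr p)"
    by (rule ennreal_leI)
  then show ?thesis
    using nn_integral_increment_le[OF s e g] unfolding g_def A_def e_def by (rule order_trans[rotated])
qed

lemma besov_seminorm_semigroup_le:
  assumes t: "0 < t" and f: "f \<in> Lp M (ennreal p)"
  shows "besov_seminorm M K p (1 / 2) (P t f)
    \<le> ennreal (besov_const p powr (1 / p) / t powr (1 / 2)) * Lnorm M (ennreal p) f"
  unfolding besov_seminorm_def
proof (rule SUP_least)
  fix s :: real assume "s \<in> {0<..}"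
  then have s: "0 < s" by simp
  define A where "A = Lp_norm M p f"
  have A: "0 \<le> A" by (simp add: A_def)
  let ?I = "\<integral>\<^sup>+y. (\<integral>\<^sup>+x. ennreal (\<bar>P t f x - P t f y\<bar> powr p) \<partial>K s y) \<partial>M"
  have le: "?I \<le> ennreal (besov_const p * ((s / t) powr (1 / 2) * A) powr p)"
    unfolding A_def by (rule nn_integral_increment_semigroup_le[OF s t f])
  \<comment> \<open>Since \<open>enn2real\<close> sends \<open>\<infinity>\<close> to
    \<open>0\<close>, finiteness is needed before \<open>ennroot\<close> can be treated as a real
    power.\<close>
  then have fin: "?I \<noteq> \<infinity>" using ennreal_less_top le_less_trans by (metis infinity_ennreal_def less_irrefl)
  have "enn2real ?I \<le> besov_const p * ((s / t) powr (1 / 2) * A) powr p"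
    using le besov_const_pos by (intro enn2real_leI) auto
  then have "enn2real ?I powr (1 / p) \<le> (besov_const p * ((s / t) powr (1 / 2) * A) powr p) powr (1 / p)"
    using p by (intro powr_mono2) auto
  also have "\<dots> = besov_const p powr (1 / p) * ((s / t) powr (1 / 2) * A)"
    using p A by (simp add: powr_mult powr_powr)
  finally have "s powr - (1 / 2) * enn2real ?I powr (1 / p)
      \<le> s powr - (1 / 2) * (besov_const p powr (1 / p) * ((s / t) powr (1 / 2) * A))"
    by (intro mult_left_mono) auto
  also have "\<dots> = besov_const p powr (1 / p) / t powr (1 / 2) * A"
    using s t by (simp add: powr_minus powr_divide field_simps)
  finally have "ennreal (s powr - (1 / 2) * enn2real ?I powr (1 / p))
      \<le> ennreal (besov_const p powr (1 / p) / t powr (1 / 2) * A)"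
    by (rule ennreal_leI)
  also have "\<dots> = ennreal (besov_const p powr (1 / p) / t powr (1 / 2)) * Lnorm M (ennreal p) f"
    using A unfolding Lnorm_eq_Lp_norm[OF p_ge_1 f] A_def by (intro ennreal_mult) auto
  also have "ennreal (s powr - (1 / 2) * enn2real ?I powr (1 / p)) = ennreal (s powr - (1 / 2)) * ennroot p ?I"
    using fin by (simp add: ennroot_def ennreal_mult)
  finally show "ennreal (s powr - (1 / 2)) * ennroot p ?I
      \<le> ennreal (besov_const p powr (1 / p) / t powr (1 / 2)) * Lnorm M (ennreal p) f" .
qed

end

end

theorem theorem0p1:
  fixes M :: "'a::topological_space measure"
    and E :: "('a \<Rightarrow> real) \<Rightarrow> ('a \<Rightarrow> real) \<Rightarrow> real"
    and F :: "('a \<Rightarrow> real) set"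
    and P :: "real \<Rightarrow> ('a \<Rightarrow> real) \<Rightarrow> 'a \<Rightarrow> real"
    and K :: "real \<Rightarrow> 'a \<Rightarrow> 'a measure"
    and p :: real
  assumes "radon_measure M"
    and "symmetric_dirichlet_form M E F"
    and "dirichlet_semigroup M E F P"
    and "heat_kernel_measures M P K"
    and "conservative M P"
    and "1 < p" and "p \<le> 2"
  shows "(\<exists>C::real. C > 0 \<and> (\<forall>f\<in>Lp M (ennreal p). \<forall>t>0.
            besov_seminorm M K p (1/2) (P t f)
              \<le> ennreal (C / t powr (1/2)) * Lnorm M (ennreal p) f)) \<and>
         (\<forall>t>0. (\<forall>f\<in>Lp M (ennreal p). P t f \<in> besov_space M K p (1/2)) \<and>
            (\<exists>B::real. B \<ge> 0 \<and> (\<forall>f\<in>Lp M (ennreal p).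
               besov_norm M K p (1/2) (P t f) \<le> ennreal B * Lnorm M (ennreal p) f)))"
proof -
  interpret markov_semigroup M P K
    by unfold_locales (use assms(3-5) in \<open>auto simp: dirichlet_semigroup_def\<close>)
  note p = \<open>1 < p\<close> \<open>p \<le> 2\<close>
  have p1: "1 \<le> p" using p by simp
  define C where "C = besov_const p powr (1 / p)"
  have C: "C > 0" using besov_const_pos[OF p] by (simp add: C_def)
  have seminorm: "besov_seminorm M K p (1/2) (P t f) \<le> ennreal (C / t powr (1/2)) * Lnorm M (ennreal p) f"
    if "t > 0" "f \<in> Lp M (ennreal p)" for t f
    unfolding C_def by (rule besov_seminorm_semigroup_le[OF p that])
  have Pt: "P t f \<in> Lp M (ennreal p)" if "t > 0" "f \<in> Lp M (ennreal p)" for t f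
    using P_Lp[OF p1 _ that(2)] that(1) by simp
  have "P t f \<in> besov_space M K p (1/2)" if t: "t > 0" and f: "f \<in> Lp M (ennreal p)" for t f
  proof -
    have "ennreal (C / t powr (1/2)) * Lnorm M (ennreal p) f < \<infinity>"
      using f by (simp add: Lp_def ennreal_mult_less_top)
    then have "besov_seminorm M K p (1/2) (P t f) < \<infinity>"
      using seminorm[OF t f] by (rule le_less_trans[rotated])
    then show ?thesis using Pt[OF t f] by (simp add: besov_space_def)
  qed
  \<comment> \<open>The summand \<open>1\<close> is the contraction on \<open>Lp\<close>, the other
    is the seminorm bound.\<close>
  moreover have "besov_norm M K p (1/2) (P t f) \<le> ennreal (1 + C / t powr (1/2)) * Lnorm M (ennreal p) f"
    if t: "t > 0" and f: "f \<in> Lp M (ennreal p)" for t f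
  proof -
    have "Lnorm M (ennreal p) (P t f) \<le> Lnorm M (ennreal p) f"
      using P_contraction[OF p1 _ f, of t] t Pt[OF t f] f p1 by (simp add: Lnorm_eq_Lp_norm)
    then have "besov_norm M K p (1/2) (P t f)
        \<le> 1 * Lnorm M (ennreal p) f + ennreal (C / t powr (1/2)) * Lnorm M (ennreal p) f"
      unfolding besov_norm_def mult_1 by (rule add_mono[OF _ seminorm[OF t f]])
    also have "\<dots> = (ennreal 1 + ennreal (C / t powr (1/2))) * Lnorm M (ennreal p) f"
      by (simp only: distrib_right ennreal_1)
    also have "ennreal 1 + ennreal (C / t powr (1/2)) = ennreal (1 + C / t powr (1/2))"
      using C by (intro ennreal_plus[symmetric]) auto
    finally show ?thesis .
  qed
  moreover have "0 \<le> 1 + C / t powr (1/2)" for t :: real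
    using C by simp
  ultimately show ?thesis
    using C seminorm by blast
qed

end
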